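(* Assume the Riemann hypothesis. Then, for real $t\to+\infty$ with $\zeta(\tfrac12+it)\neq 0$, $$\sum_{\gamma}\frac{1}{(t-\gamma)^2}=-\frac{\mathrm d}{\mathrm dt}\left\{\frac{Z'(t)}{Z(t)}\right\}+O\left(\frac1t\right),$$ where the sum runs over the ordinates $\gamma$ of all nontrivial zeros $\tfrac12+i\gamma$ of $\zeta$ (positive and negative, counted with multiplicity).
   Context: $\zeta$ is the Riemann zeta function. For real $t>0$, $Z(t)=e^{i\vartheta(t)}\zeta(\tfrac12+it)$, where $\vartheta(t)=\operatorname{Im}\log\Gamma(\tfrac14+\tfrac{it}{2})-\tfrac{t}{2}\ln\pi$ is the Riemann–Siegel theta function (continuous branch with $\vartheta(0)=0$); $Z$ is real-valued and smooth. The $O(1/t)$ means there are constants $K,T>0$ such that the error is at most $K/t$ in absolute value for all $t\ge T$ with $\zeta(\tfrac12+it)\ne0$. *)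

theory Defs
  imports "HOL-Complex_Analysis.Complex_Analysis"
begin

text \<open>
  The analytic continuation is unique by the identity theorem; the pole at \<open>1\<close> is filled
  with the arbitrary value \<open>0\<close> so that the description determines a total function.
\<close>
definition riemann_zeta :: "complex \<Rightarrow> complex" where
  "riemann_zeta = (THE f. f holomorphic_on (- {1}) \<and>
     (\<forall>s. Re s > 1 \<longrightarrow> (\<lambda>n. 1 / of_nat (Suc n) powr s) sums f s) \<and> f 1 = 0)"

definition nontrivial_zeros :: "complex set" where
  "nontrivial_zeros = {\<rho>. 0 < Re \<rho> \<and> Re \<rho> < 1 \<and> riemann_zeta \<rho> = 0}"

definition riemann_hypothesis :: bool where
  "riemann_hypothesis \<longleftrightarrow> (\<forall>\<rho>\<in>nontrivial_zeros. Re \<rho> = 1 / 2)"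

text \<open>
  The library function \<^const>\<open>ln_Gamma\<close> is the logarithm of \<open>\<Gamma>\<close> that is holomorphic off
  the nonpositive real axis and real on the positive one, so the branch below is the continuous
  one vanishing at \<open>0\<close>.
\<close>
definition riemann_siegel_theta :: "real \<Rightarrow> real" where
  "riemann_siegel_theta t = Im (ln_Gamma (1 / 4 + \<i> * of_real t / 2)) - t / 2 * ln pi"

text \<open>
  The values are real by the functional equation, but this is not built into the type:
  derivatives are taken of the complex-valued function of a real variable.
\<close>
definition hardy_Z :: "real \<Rightarrow> complex" where
  "hardy_Z t = exp (\<i> * of_real (riemann_siegel_theta t)) * riemann_zeta (1 / 2 + \<i> * of_real t)"

end

(*
  Let xi(s) = s (s - 1) pi^(-s/2) Gamma(s/2) zeta(s), normalised by xi(0) = 1. The Mellin transform of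
  the theta function, split at 1 and folded with the theta transformation, exhibits xi as an entire
  function with xi(1 - s) = xi(s) and log |xi(s)| = O(|s|^(3/2)); its zeros are the nontrivial zeros
  because zeta does not vanish on Re s >= 1.

  For an entire f with f(0) = 1 and log |f(z)| = o(|z|^2), dividing out Blaschke factors for the zeros
  in a disc of radius R leaves the exponential of a holomorphic function whose second derivative is
  o(1) by Borel-Caratheodory and Cauchy; hence (f'/f)'(z) = - lim sum 1/(z - rho)^2, without a Hadamard
  product. On the critical line all terms have one sign, so the limit is an absolutely convergent sum.

  Finally Z'/Z = i theta' + i zeta'/zeta, and (xi'/xi)' differs from (zeta'/zeta)' by a trigamma value
  and 1/(s - 1)^2, while theta'' is also a trigamma value. All these are O(1/t).
*)
theory Submission
  imports Defs "HOL-Probability.Characteristic_Functions" "HOL-Real_Asymp.Real_Asymp"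
begin

section \<open>Zeros of entire functions of order less than two\<close>

text \<open>The definition presents zeta only as the solution of a continuation problem, so no
  property of it is available at the start. For this reason xi is built first, from an integral
  whose symmetry and entireness can be read off; zeta is found afterwards as xi times explicit
  factors, through the Dirichlet series in Re s > 1 and the identity theorem. The functional
  equation is then a symmetry of a formula. The price is that growth must be read off the integral
  too. The exponent 3/2 is crude, the true size being |s| log |s|, but every exponent below 2
  serves: dividing out the zeros up to R costs an error of size log max |f| / R^2 in the second
  derivative of log f. Differentiating twice is also what disposes of the exponential factors in a
  Hadamard product, since the logarithm of such a factor has degree one. The approximation yields a
  limit along discs centred at 0 only, and this is the obstacle that the Riemann hypothesis removes:
  with z - rho = i (t - gamma) every term is a negative multiple of a square, so order of summation
  ceases to matter.\<close>

lemma entire_factor_zorder: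
  assumes g: "g holomorphic_on UNIV" and "g w \<noteq> 0"
  obtains h where "h holomorphic_on UNIV" "h \<rho> \<noteq> 0"
    "\<And>z. g z = h z * (z - \<rho>) ^ nat (zorder g \<rho>)"
proof -
  define n where "n = nat (zorder g \<rho>)"
  have "(if g \<rho> = 0 then zorder g \<rho> > 0 else zorder g \<rho> = 0) \<and>
     (\<exists>r. r > 0 \<and> cball \<rho> r \<subseteq> UNIV \<and> zor_poly g \<rho> holomorphic_on cball \<rho> r \<and>
      (\<forall>z\<in>cball \<rho> r. g z = zor_poly g \<rho> z * (z - \<rho>) ^ nat (zorder g \<rho>) \<and> zor_poly g \<rho> z \<noteq> 0))"
    by (rule zorder_exist_zero[OF g]) (use assms in auto)
  then obtain r where r: "r > 0" "zor_poly g \<rho> holomorphic_on cball \<rho> r"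
    "\<And>z. z \<in> cball \<rho> r \<Longrightarrow> g z = zor_poly g \<rho> z * (z - \<rho>) ^ n"
    "\<And>z. z \<in> cball \<rho> r \<Longrightarrow> zor_poly g \<rho> z \<noteq> 0"
    unfolding n_def by blast
  \<comment> \<open>The removable singularity is filled with the value of \<open>zor_poly\<close>;
    the one function \<open>h\<close> is then holomorphic on two open sets that cover the
    plane.\<close>
  define h where "h z = (if z = \<rho> then zor_poly g \<rho> \<rho> else g z / (z - \<rho>) ^ n)" for z
  have 1: "h holomorphic_on ball \<rho> r"
  proof (rule holomorphic_transform)
    show "zor_poly g \<rho> holomorphic_on ball \<rho> r"
      using r(2) holomorphic_on_subset ball_subset_cball by blast
  qed (auto simp: h_def r(3))
  have 2: "h holomorphic_on -{\<rho>}"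
  proof (rule holomorphic_transform)
    show "(\<lambda>z. g z / (z - \<rho>) ^ n) holomorphic_on -{\<rho>}"
      by (intro holomorphic_intros holomorphic_on_subset[OF g]) auto
  qed (auto simp: h_def)
  have "h holomorphic_on (ball \<rho> r \<union> -{\<rho>})"
    by (rule holomorphic_on_Un[OF 1 2]) auto
  moreover have "ball \<rho> r \<union> -{\<rho>} = UNIV" using r(1) by auto
  ultimately have 3: "h holomorphic_on UNIV" by simp
  show ?thesis
  proof (rule that[OF 3])
    show "h \<rho> \<noteq> 0" using r(1,4) by (auto simp: h_def)
    show "g z = h z * (z - \<rho>) ^ nat (zorder g \<rho>)" for z
      using r(1) r(3)[of \<rho>] by (auto simp: h_def n_def)
  qed
qed

text \<open>Induction over \<open>Z\<close>: the factors already removed do not vanish at the next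
  point, so the quotient still has there the order that \<open>f\<close> has. The point
  \<open>w\<close> rules out the zero function, for which \<open>zorder\<close> carries no
  information.\<close>

lemma entire_factor_zeros:
  assumes f: "f holomorphic_on UNIV" and w: "f w \<noteq> 0" and "finite Z"
  obtains g where "g holomorphic_on UNIV" "\<And>\<rho>. \<rho> \<in> Z \<Longrightarrow> g \<rho> \<noteq> 0"
    "\<And>z. f z = g z * (\<Prod>\<rho>\<in>Z. (z - \<rho>) ^ nat (zorder f \<rho>))"
proof -
  have "\<exists>g. g holomorphic_on UNIV \<and> (\<forall>\<rho>\<in>Z. g \<rho> \<noteq> 0) \<and>
     (\<forall>z. f z = g z * (\<Prod>\<rho>\<in>Z. (z - \<rho>) ^ nat (zorder f \<rho>)))"
    using \<open>finite Z\<close>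
  proof induction
    case empty
    then show ?case using f by (intro exI[of _ f]) auto
  next
    case (insert \<rho> Z)
    then obtain g where g: "g holomorphic_on UNIV" "\<And>\<rho>. \<rho> \<in> Z \<Longrightarrow> g \<rho> \<noteq> 0"
      "\<And>z. f z = g z * (\<Prod>\<rho>\<in>Z. (z - \<rho>) ^ nat (zorder f \<rho>))" by blast
    define P where "P z = (\<Prod>\<rho>\<in>Z. (z - \<rho>) ^ nat (zorder f \<rho>))" for z
    have P: "P holomorphic_on UNIV" unfolding P_def by (intro holomorphic_intros)
    have gw: "g w \<noteq> 0" using g(3) w by auto
    have fP: "f = (\<lambda>z. g z * P z)" using g(3) by (auto simp: P_def)
    have P0: "P \<rho> \<noteq> 0" using insert.hyps by (auto simp: P_def)
    have an: "F analytic_on {x}" if "F holomorphic_on UNIV" for F :: "complex \<Rightarrow> complex" and x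
      using that analytic_on_open[of UNIV F] analytic_on_subset by blast
    have ev: "eventually (\<lambda>z. f z \<noteq> 0) (at \<rho>)"
      by (rule non_zero_neighbour_alt[OF f, where \<beta> = w, THEN eventually_mono]) (use w in auto)
    have "zorder f \<rho> = zorder g \<rho> + zorder P \<rho>"
      unfolding fP by (rule zorder_times_analytic) (use an g(1) P ev fP in auto)
    moreover have "zorder P \<rho> = 0"
      by (rule zorder_eq_0I[OF an[OF P] P0])
    ultimately have zg: "zorder g \<rho> = zorder f \<rho>" by simp
    obtain h where h: "h holomorphic_on UNIV" "h \<rho> \<noteq> 0"
      "\<And>z. g z = h z * (z - \<rho>) ^ nat (zorder g \<rho>)"
      using entire_factor_zorder[OF g(1) gw] by metis
    show ?case
    proof (intro exI[of _ h] conjI ballI allI h(1))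
      fix x assume "x \<in> insert \<rho> Z"
      then show "h x \<noteq> 0" using h(2) h(3)[of x] g(2)[of x] by auto
    next
      fix z
      show "f z = h z * (\<Prod>\<rho>\<in>insert \<rho> Z. (z - \<rho>) ^ nat (zorder f \<rho>))"
        using insert.hyps g(3)[of z] h(3)[of z] zg by (simp add: mult_ac)
    qed
  qed
  then show ?thesis using that by blast
qed

text \<open>The Moebius map v -> v / (2A - v) sends the half-plane Re v < A into the unit disc and
  fixes 0, so the Schwarz lemma applies after rescaling. For |z| <= R/2 it gives |u| <= |2A - u| /
  2, hence |u| <= 2A.\<close>

lemma Borel_Caratheodory_half:
  assumes u: "u holomorphic_on ball 0 R" and u0: "u 0 = 0" and "R > 0"
    and less: "\<And>z. z \<in> ball 0 R \<Longrightarrow> Re (u z) < A" and z: "norm z \<le> R / 2"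
  shows "norm (u z) \<le> 2 * A"
proof -
  define w where "w \<zeta> = u (of_real R * \<zeta>) / (of_real (2 * A) - u (of_real R * \<zeta>))" for \<zeta>
  have A: "A > 0" using less[of 0] u0 \<open>R > 0\<close> by simp
  have in_ball: "of_real R * \<zeta> \<in> ball 0 R" if "norm \<zeta> < 1" for \<zeta> :: complex
    using that \<open>R > 0\<close> by (auto simp: norm_mult)
  have key: "norm v < norm (of_real (2 * A) - v)" if "Re v < A" for v
  proof -
    have "(norm v)^2 < (norm (of_real (2 * A) - v))^2"
      using that A unfolding cmod_power2
      by (simp add: power2_eq_square algebra_simps)
    then show ?thesis by (simp add: power2_less_imp_less)
  qed
  have nz: "of_real (2 * A) - u (of_real R * \<zeta>) \<noteq> 0" if "norm \<zeta> < 1" for \<zeta>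
    using key[OF less[OF in_ball[OF that]]] by auto
  have "w holomorphic_on ball 0 1"
    unfolding w_def
    by (intro holomorphic_intros holomorphic_on_compose_gen[of "\<lambda>\<zeta>. of_real R * \<zeta>" _ u "ball 0 R", unfolded o_def] u)
       (use nz in_ball in auto)
  moreover have "w 0 = 0" by (simp add: w_def u0)
  moreover have "norm (w \<zeta>) < 1" if "norm \<zeta> < 1" for \<zeta>
    using key[OF less[OF in_ball[OF that]]] nz[OF that] by (simp add: w_def norm_divide divide_simps)
  ultimately have S: "norm (w \<zeta>) \<le> norm \<zeta>" if "norm \<zeta> < 1" for \<zeta>
    using Schwarz_Lemma(1)[of w \<zeta>] that by blast
  define \<zeta> where "\<zeta> = z / of_real R"
  have \<zeta>: "norm \<zeta> \<le> 1 / 2" "of_real R * \<zeta> = z"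
    using z \<open>R > 0\<close> by (auto simp: \<zeta>_def norm_divide field_simps)
  have n1: "norm \<zeta> < 1" using \<zeta> by linarith
  have "norm (u z) / norm (of_real (2 * A) - u z) \<le> 1 / 2"
    using order_trans[OF S[OF n1] \<zeta>(1)] by (simp only: w_def norm_divide \<zeta>(2))
  then have "norm (u z) \<le> norm (of_real (2 * A) - u z) / 2"
    using nz[OF n1] \<zeta> by (simp add: divide_simps mult.commute)
  also have "norm (of_real (2 * A) - u z) \<le> norm (of_real (2 * A) :: complex) + norm (u z)"
    by (rule norm_triangle_ineq4)
  also have "norm (of_real (2 * A) :: complex) = 2 * A" using A by (simp only: norm_of_real)
  finally show ?thesis by simp
qed

lemma finite_entire_zeros_cball:
  assumes f: "f holomorphic_on UNIV" and w: "f w \<noteq> 0"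
  shows "finite {\<rho>. f \<rho> = 0 \<and> norm \<rho> \<le> R}"
proof -
  have "\<not> f constant_on UNIV \<or> (\<forall>z. f z \<noteq> 0)"
    using w by (auto simp: constant_on_def)
  then show ?thesis
  proof
    assume "\<not> f constant_on UNIV"
    then have "finite {z \<in> cball 0 R. f z = 0}"
      using holomorphic_compact_finite_zeros[OF f, of "cball 0 R"] by auto
    then show ?thesis by (rule rev_finite_subset) (auto simp: dist_norm)
  qed auto
qed

text \<open>Zeros are taken from |z| <= R, but the Blaschke factors belong to the disc of radius 2R.
  They have modulus 1 on |z| = 2R, which bounds the quotient \<open>G\<close>, and modulus at most
  1/2 at 0, which bounds the number of zeros. The constant 100 is 96 + 4: the logarithm of
  \<open>G\<close> in \<open>h2\<close>, the reflected zeros in \<open>h3\<close>.\<close>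

lemma entire_deriv_logderiv_approx:
  fixes f :: "complex \<Rightarrow> complex" and R M :: real
  assumes f: "f holomorphic_on UNIV" and f0: "f 0 = 1" and R: "R > 0"
    and M: "\<And>w. norm w = 2 * R \<Longrightarrow> norm (f w) \<le> exp M"
    and z0: "norm z0 \<le> R / 4" "f z0 \<noteq> 0"
  defines "Z \<equiv> {\<rho>. f \<rho> = 0 \<and> norm \<rho> \<le> R}"
  shows "norm (deriv (\<lambda>z. deriv f z / f z) z0 + (\<Sum>\<rho>\<in>Z. of_int (zorder f \<rho>) / (z0 - \<rho>)\<^sup>2))
           \<le> 100 * (M + 1) / R\<^sup>2"
proof -
  define m where "m \<rho> = nat (zorder f \<rho>)" for \<rho>
  have fin: "finite Z" unfolding Z_def by (rule finite_entire_zeros_cball[OF f, of 0]) (simp add: f0)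
  obtain g where g: "g holomorphic_on UNIV" "\<And>\<rho>. \<rho> \<in> Z \<Longrightarrow> g \<rho> \<noteq> 0"
    "\<And>z. f z = g z * (\<Prod>\<rho>\<in>Z. (z - \<rho>) ^ m \<rho>)"
    using entire_factor_zeros[OF f, of 0 Z] fin f0 unfolding m_def by auto
  have mpos: "zorder f \<rho> = int (m \<rho>)" if "\<rho> \<in> Z" for \<rho>
  proof -
    have "\<exists>w\<in>UNIV. f w \<noteq> 0" using f0 by (intro bexI[of _ 0]) auto
    then have "zorder f \<rho> \<ge> 0"
      using zorder_exist_zero[OF f open_UNIV connected_UNIV UNIV_I, of \<rho>] by (auto split: if_splits)
    then show ?thesis by (simp add: m_def)
  qed
  \<comment> \<open>\<open>(z - \<rho>) / b \<rho> z\<close> is the Blaschke factor;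
    \<open>b \<rho>\<close> vanishes only at the reflected zero 4R^2 / cnj rho, at distance at least
    4R from 0.\<close>
  define b where "b \<rho> z = (of_real (4 * R\<^sup>2) - cnj \<rho> * z) / of_real (2 * R)" for \<rho> z :: complex
  define G where "G z = g z * (\<Prod>\<rho>\<in>Z. b \<rho> z ^ m \<rho>)" for z
  have G: "G holomorphic_on UNIV"
    unfolding G_def b_def using R by (intro holomorphic_intros g(1)) auto
  have bnz: "b \<rho> z \<noteq> 0" if "\<rho> \<in> Z" "norm z \<le> R" for \<rho> z
  proof
    assume "b \<rho> z = 0"
    then have "of_real (4 * R\<^sup>2) = cnj \<rho> * z" using R by (simp add: b_def)
    then have "norm (of_real (4 * R\<^sup>2) :: complex) = norm \<rho> * norm z"
      by (metis complex_mod_cnj norm_mult)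
    also have "norm (of_real (4 * R\<^sup>2) :: complex) = 4 * R\<^sup>2" by (simp only: norm_of_real) simp
    also have "norm \<rho> * norm z \<le> R * R" using that R by (intro mult_mono) (auto simp: Z_def)
    finally show False using R by (simp add: power2_eq_square)
  qed
  have gnz: "g z \<noteq> 0" if "norm z \<le> R" for z
  proof (cases "z \<in> Z")
    case False
    then have "f z \<noteq> 0" using that by (auto simp: Z_def)
    then show ?thesis using g(3)[of z] by auto
  qed (use g in auto)
  have Gnz: "G z \<noteq> 0" if "norm z \<le> R" for z
    using gnz[OF that] bnz[OF _ that] fin by (auto simp: G_def)
  have bdry: "norm (G z) \<le> exp M" if "norm z = 2 * R" for z
  proof -
    have "norm (b \<rho> z) = norm (z - \<rho>)" for \<rho>
    proof -
      have "of_real (4 * R\<^sup>2) = cnj z * z"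
        using that by (simp add: complex_norm_square[symmetric] mult.commute power2_eq_square)
      then have "b \<rho> z = cnj (z - \<rho>) * z / of_real (2 * R)"
        by (simp add: b_def algebra_simps)
      then have "norm (b \<rho> z) = norm (cnj (z - \<rho>)) * norm z / norm (of_real (2 * R) :: complex)"
        by (simp only: norm_mult norm_divide)
      then show ?thesis using R that by (simp del: complex_cnj_diff)
    qed
    then have "norm (G z) = norm (f z)"
      by (simp add: G_def g(3)[of z] norm_mult prod_norm[symmetric] norm_power)
    then show ?thesis using M[OF that] by simp
  qed
  have Gle: "norm (G z) \<le> exp M" if "norm z \<le> 2 * R" for z
  proof (rule maximum_modulus_frontier[of G "cball 0 (2 * R)"])
    show "G holomorphic_on interior (cball 0 (2 * R))" using G holomorphic_on_subset by blast
    show "continuous_on (closure (cball 0 (2 * R))) G"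
      using G holomorphic_on_imp_continuous_on continuous_on_subset by blast
  qed (use bdry R that in auto)
  \<comment> \<open>Jensen's inequality in multiplicative form: in passing from f(0) = 1 to G(0),
    each zero contributes 2R / |rho| >= 2. The maximum principle then bounds the number of zeros by
    M / ln 2.\<close>
  have G0: "norm (G 0) \<ge> 2 ^ (\<Sum>\<rho>\<in>Z. m \<rho>)"
  proof -
    have "norm (b \<rho> 0) = 2 * R" for \<rho> using R
      by (simp add: b_def power2_eq_square norm_mult)
    then have eq: "norm (G 0) = norm (g 0) * (\<Prod>\<rho>\<in>Z. (2 * R) ^ m \<rho>)"
      by (simp add: G_def norm_mult prod_norm[symmetric] norm_power)
    have f1: "norm (g 0) * (\<Prod>\<rho>\<in>Z. norm \<rho> ^ m \<rho>) = 1"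
      using arg_cong[OF g(3)[of 0], of norm] f0 by (simp add: norm_mult prod_norm[symmetric] norm_power)
    have "2 ^ (\<Sum>\<rho>\<in>Z. m \<rho>) = (\<Prod>\<rho>\<in>Z. (2::real) ^ m \<rho>) * (norm (g 0) * (\<Prod>\<rho>\<in>Z. norm \<rho> ^ m \<rho>))"
      unfolding f1 by (simp add: power_sum)
    also have "\<dots> = norm (g 0) * (\<Prod>\<rho>\<in>Z. (2 * norm \<rho>) ^ m \<rho>)"
      by (simp add: power_mult_distrib prod.distrib)
    also have "\<dots> \<le> norm (G 0)"
      unfolding eq by (intro mult_left_mono prod_mono conjI power_mono) (auto simp: Z_def)
    finally show ?thesis .
  qed
  define N where "N = (\<Sum>\<rho>\<in>Z. m \<rho>)"
  have N: "N * ln 2 \<le> M"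
  proof -
    have "(2::real) ^ N \<le> exp M" using G0 Gle[of 0] R unfolding N_def by simp
    then have "ln ((2::real) ^ N) \<le> M" by (metis ln_exp ln_le_cancel_iff exp_gt_zero zero_less_numeral zero_less_power)
    then show ?thesis by (simp add: ln_realpow)
  qed
  have M0: "M \<ge> 0" using N ln_gt_zero[of 2] by (smt (verit) mult_nonneg_nonneg of_nat_0_le_iff)
  have Nle: "real N \<le> 2 * M"
  proof -
    have "real N * (1/2) \<le> N * ln 2" using ln2_ge_two_thirds by (intro mult_left_mono) auto
    then show ?thesis using N by simp
  qed
  obtain h where h: "h holomorphic_on ball 0 R" "\<And>z. z \<in> ball 0 R \<Longrightarrow> G z = exp (h z)"
  proof (rule contractible_imp_holomorphic_log[of G "ball 0 R"])
    show "G holomorphic_on ball 0 R" using G by (rule holomorphic_on_subset) auto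
    show "contractible (ball (0::complex) R)" by (intro convex_imp_contractible convex_ball)
    show "G z \<noteq> 0" if "z \<in> ball 0 R" for z using Gnz[of z] that by simp
  qed (rule that)
  \<comment> \<open>\<open>M + 1\<close> in place of \<open>M\<close> makes the bound on the real
    part strict. At the centre |G(0)| >= 1 gives Re (h 0) >= 0.\<close>
  have BC: "norm (h z - h 0) \<le> 2 * (M + 1)" if "norm z \<le> R / 2" for z
  proof (rule Borel_Caratheodory_half[where R = R and u = "\<lambda>z. h z - h 0"])
    fix z :: complex assume z: "z \<in> ball 0 R"
    have eq: "norm (G x) = exp (Re (h x))" if "x \<in> ball 0 R" for x
      by (simp only: h(2)[OF that] norm_exp_eq_Re)
    have "exp (Re (h z)) \<le> exp M" using Gle[of z] z R by (simp add: eq[OF z, symmetric])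
    moreover have "1 \<le> exp (Re (h 0))"
    proof -
      have "1 \<le> (2::real) ^ (\<Sum>\<rho>\<in>Z. m \<rho>)" by (rule one_le_power) simp
      also note G0
      also have "norm (G 0) = exp (Re (h 0))" using R by (intro eq) simp
      finally show ?thesis .
    qed
    ultimately show "Re (h z - h 0) < M + 1" by simp
  qed (use h(1) R that in \<open>auto intro!: holomorphic_intros\<close>)
  have sub: "cball z0 (R/4) \<subseteq> cball 0 (R/2)"
  proof
    fix x assume "x \<in> cball z0 (R/4)"
    then have "norm (x - z0) \<le> R/4" by (simp add: dist_norm norm_minus_commute)
    then show "x \<in> cball 0 (R/2)" using z0(1) norm_triangle_ineq[of "x - z0" z0] by simp
  qed
  have sub2: "cball z0 (R/4) \<subseteq> ball 0 R" using sub R by (force)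
  \<comment> \<open>The Cauchy estimate asks for values in an open ball, so 2(M + 1) is relaxed to
    3(M + 1). The disc of radius R/4 about \<open>z0\<close> stays in |z| <= R/2, and 2 times 3
    times 16 is 96.\<close>
  have "norm ((deriv ^^ 2) h z0) \<le> fact 2 * (3 * (M + 1)) / (R/4)^2"
  proof (rule Cauchy_higher_deriv_bound[where y = "h 0"])
    show "h holomorphic_on ball z0 (R/4)" using h(1) sub2 ball_subset_cball holomorphic_on_subset by (metis subset_trans)
    show "continuous_on (cball z0 (R/4)) h" using h(1) sub2 holomorphic_on_imp_continuous_on continuous_on_subset by blast
    fix w assume "w \<in> ball z0 (R/4)"
    then have "w \<in> cball 0 (R/2)" using subsetD[OF sub] by simp
    then have "norm w \<le> R/2" by simp
    from BC[OF this] show "h w \<in> ball (h 0) (3 * (M + 1))"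
      using M0 by (simp add: dist_norm norm_minus_commute)
  qed (use R in auto)
  also have "fact 2 * (3 * (M + 1)) / (R/4)^2 = 96 * (M + 1) / R\<^sup>2"
    by (simp add: power_divide fact_numeral)
  finally have h2: "norm (deriv (deriv h) z0) \<le> 96 * (M + 1) / R\<^sup>2"
    by (simp add: numeral_2_eq_2)
  define B where "B \<rho> z = (z - \<rho>) / b \<rho> z" for \<rho> z
  \<comment> \<open>The logarithmic derivative of the Blaschke factor; its second summand belongs to
    the reflected zero.\<close>
  define L where "L \<rho> z = 1 / (z - \<rho>) + cnj \<rho> / (of_real (4 * R\<^sup>2) - cnj \<rho> * z)" for \<rho> z
  have bnz': "of_real (4 * R\<^sup>2) - cnj \<rho> * z \<noteq> 0" if "\<rho> \<in> Z" "norm z \<le> R" for \<rho> z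
    using bnz[OF that] by (auto simp: b_def)
  \<comment> \<open>The formula for f'/f is differentiated once more, so it must hold on a
    neighbourhood of \<open>z0\<close>.\<close>
  define V where "V = ball 0 R \<inter> {z. f z \<noteq> 0}"
  have contf: "continuous_on UNIV f" using f holomorphic_on_imp_continuous_on by blast
  have V: "open V" unfolding V_def
    by (intro open_Int open_ball open_Collect_neq contf continuous_on_const)
  have z0V: "z0 \<in> V" using z0 R by (auto simp: V_def)
  have ld: "deriv f z / f z = deriv h z + (\<Sum>\<rho>\<in>Z. of_nat (m \<rho>) * L \<rho> z)" if "z \<in> V" for z
  proof -
    have zR: "norm z \<le> R" "z \<in> ball 0 R" "f z \<noteq> 0" using that by (auto simp: V_def)
    have zZ: "z \<noteq> \<rho>" if "\<rho> \<in> Z" for \<rho> using zR that by (auto simp: Z_def)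
    have Bnz: "B \<rho> z \<noteq> 0" if "\<rho> \<in> Z" for \<rho> using zZ[OF that] bnz[OF that zR(1)] by (auto simp: B_def)
    have dB: "((\<lambda>z. B \<rho> z ^ m \<rho>) has_field_derivative (B \<rho> z ^ m \<rho> * (of_nat (m \<rho>) * L \<rho> z))) (at z)"
      if "\<rho> \<in> Z" for \<rho>
    proof -
      define c where "c = complex_of_real (2 * R)"
      define d where "d = z - \<rho>"
      have nz: "c \<noteq> 0" "d \<noteq> 0" "b \<rho> z \<noteq> 0"
        using R zZ[OF that] bnz[OF that zR(1)] by (auto simp: c_def d_def)
      have "(b \<rho> has_field_derivative - cnj \<rho> / c) (at z)"
        unfolding b_def c_def using R by (auto intro!: derivative_eq_intros)
      then have "(B \<rho> has_field_derivative (1 * b \<rho> z - d * (- cnj \<rho> / c)) / (b \<rho> z * b \<rho> z)) (at z)"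
        unfolding B_def d_def using nz by (intro DERIV_divide) (auto intro!: derivative_eq_intros)
      moreover have L: "L \<rho> z = 1 / d + cnj \<rho> / (c * b \<rho> z)"
        using nz by (simp add: L_def d_def b_def c_def)
      have "(1 * b \<rho> z - d * (- cnj \<rho> / c)) / (b \<rho> z * b \<rho> z) = B \<rho> z * L \<rho> z"
        using nz unfolding L B_def d_def[symmetric] by (simp add: field_simps)
      ultimately have "(B \<rho> has_field_derivative B \<rho> z * L \<rho> z) (at z)" by simp
      note D = DERIV_power[OF this, of "m \<rho>"]
      have "of_nat (m \<rho>) * (B \<rho> z * L \<rho> z * B \<rho> z ^ (m \<rho> - Suc 0)) = B \<rho> z ^ m \<rho> * (of_nat (m \<rho>) * L \<rho> z)"
        by (cases "m \<rho>") simp_all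
      with D show ?thesis by (simp only:)
    qed
    have "((\<lambda>u. \<Prod>\<rho>\<in>Z. B \<rho> u ^ m \<rho>) has_field_derivative
        ((\<Prod>\<rho>\<in>Z. B \<rho> z ^ m \<rho>) * (\<Sum>\<rho>\<in>Z. (B \<rho> z ^ m \<rho> * (of_nat (m \<rho>) * L \<rho> z)) / B \<rho> z ^ m \<rho>))) (at z)"
      by (rule has_field_derivative_prod') (use Bnz dB in auto)
    also have "(\<Sum>\<rho>\<in>Z. (B \<rho> z ^ m \<rho> * (of_nat (m \<rho>) * L \<rho> z)) / B \<rho> z ^ m \<rho>) = (\<Sum>\<rho>\<in>Z. of_nat (m \<rho>) * L \<rho> z)"
      using Bnz by (intro sum.cong) auto
    finally have dP: "((\<lambda>u. \<Prod>\<rho>\<in>Z. B \<rho> u ^ m \<rho>) has_field_derivative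
        ((\<Prod>\<rho>\<in>Z. B \<rho> z ^ m \<rho>) * (\<Sum>\<rho>\<in>Z. of_nat (m \<rho>) * L \<rho> z))) (at z)" .
    have dh: "(h has_field_derivative deriv h z) (at z)"
      using h(1) zR(2) holomorphic_derivI[of h "ball 0 R"] by auto
    have feq: "f u = exp (h u) * (\<Prod>\<rho>\<in>Z. B \<rho> u ^ m \<rho>)" if "u \<in> ball 0 R" for u
    proof -
      have "norm u \<le> R" using that by simp
      then have "(\<Prod>\<rho>\<in>Z. b \<rho> u ^ m \<rho>) \<noteq> 0" using bnz fin by auto
      then show ?thesis using g(3)[of u]
        by (simp add: h(2)[OF that, symmetric] G_def B_def power_divide prod_dividef)
    qed
    have "((\<lambda>u. exp (h u) * (\<Prod>\<rho>\<in>Z. B \<rho> u ^ m \<rho>)) has_field_derivative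
       f z * (deriv h z + (\<Sum>\<rho>\<in>Z. of_nat (m \<rho>) * L \<rho> z))) (at z)"
      by (rule derivative_eq_intros dP dh refl)+ (simp add: feq[OF zR(2)] algebra_simps)
    then have "(f has_field_derivative
       f z * (deriv h z + (\<Sum>\<rho>\<in>Z. of_nat (m \<rho>) * L \<rho> z))) (at z)"
      by (rule has_field_derivative_transform_within_open[where S = "ball 0 R"]) (use zR feq in auto)
    then show ?thesis using zR by (simp add: DERIV_imp_deriv)
  qed
  define T where "T \<rho> = -1 / (z0 - \<rho>)\<^sup>2 + (cnj \<rho> / (of_real (4 * R\<^sup>2) - cnj \<rho> * z0))\<^sup>2" for \<rho>
  have z0R: "norm z0 \<le> R" "z0 \<in> ball 0 R" using z0 R by auto
  have dL: "(L \<rho> has_field_derivative T \<rho>) (at z0)" if "\<rho> \<in> Z" for \<rho>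
  proof -
    have "z0 \<noteq> \<rho>" using z0 that by (auto simp: Z_def)
    then show ?thesis unfolding L_def T_def using bnz'[OF that z0R(1)]
      by (auto intro!: derivative_eq_intros simp: power2_eq_square)
  qed
  have "(deriv h has_field_derivative deriv (deriv h) z0) (at z0)"
    using h(1) z0R(2) holomorphic_deriv[of h "ball 0 R"] holomorphic_derivI[of "deriv h" "ball 0 R"] by auto
  then have "((\<lambda>z. deriv h z + (\<Sum>\<rho>\<in>Z. of_nat (m \<rho>) * L \<rho> z)) has_field_derivative
     deriv (deriv h) z0 + (\<Sum>\<rho>\<in>Z. of_nat (m \<rho>) * T \<rho>)) (at z0)"
    by (intro DERIV_add DERIV_sum DERIV_cmult dL)
  then have "((\<lambda>z. deriv f z / f z) has_field_derivative
     deriv (deriv h) z0 + (\<Sum>\<rho>\<in>Z. of_nat (m \<rho>) * T \<rho>)) (at z0)"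
    by (rule has_field_derivative_transform_within_open[OF _ V z0V]) (simp add: ld)
  then have "deriv (\<lambda>z. deriv f z / f z) z0 = deriv (deriv h) z0 + (\<Sum>\<rho>\<in>Z. of_nat (m \<rho>) * T \<rho>)"
    by (rule DERIV_imp_deriv)
  moreover have "(\<Sum>\<rho>\<in>Z. of_int (zorder f \<rho>) / (z0 - \<rho>)\<^sup>2) = (\<Sum>\<rho>\<in>Z. of_nat (m \<rho>) / (z0 - \<rho>)\<^sup>2)"
    by (intro sum.cong) (auto simp: mpos)
  ultimately have eq: "deriv (\<lambda>z. deriv f z / f z) z0 + (\<Sum>\<rho>\<in>Z. of_int (zorder f \<rho>) / (z0 - \<rho>)\<^sup>2)
     = deriv (deriv h) z0 + (\<Sum>\<rho>\<in>Z. of_nat (m \<rho>) * (cnj \<rho> / (of_real (4 * R\<^sup>2) - cnj \<rho> * z0))\<^sup>2)"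
    by (simp add: T_def ring_distribs sum.distrib sum_subtractf)
  \<comment> \<open>Reflected zeros are far away: |rho| <= R and |z0| <= R bound each quotient by R
    / (3R^2) before squaring, and there are \<open>N\<close> <= 2M of them with
    multiplicity.\<close>
  have "norm (\<Sum>\<rho>\<in>Z. of_nat (m \<rho>) * (cnj \<rho> / (of_real (4 * R\<^sup>2) - cnj \<rho> * z0))\<^sup>2)
     \<le> (\<Sum>\<rho>\<in>Z. real (m \<rho>) * (1 / (9 * R\<^sup>2)))"
  proof (intro sum_norm_le)
    fix \<rho> assume "\<rho> \<in> Z"
    then have r: "norm \<rho> \<le> R" by (auto simp: Z_def)
    have "3 * R\<^sup>2 \<le> 4 * R\<^sup>2 - norm (cnj \<rho> * z0)"
      using mult_mono[OF r z0R(1)] R by (simp add: norm_mult power2_eq_square)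
    also have "4 * R\<^sup>2 = norm (complex_of_real (4 * R\<^sup>2))" by (simp only: norm_of_real) simp
    also have "\<dots> - norm (cnj \<rho> * z0) \<le> norm (of_real (4 * R\<^sup>2) - cnj \<rho> * z0)"
      by (rule norm_triangle_ineq2)
    finally have d: "3 * R\<^sup>2 \<le> norm (of_real (4 * R\<^sup>2) - cnj \<rho> * z0)" .
    have "norm (cnj \<rho> / (of_real (4 * R\<^sup>2) - cnj \<rho> * z0)) \<le> R / (3 * R\<^sup>2)"
      unfolding norm_divide using r d R by (intro frac_le) auto
    also have "\<dots> = 1 / (3 * R)" using R by (simp add: power2_eq_square)
    finally have "(norm (cnj \<rho> / (of_real (4 * R\<^sup>2) - cnj \<rho> * z0)))\<^sup>2 \<le> (1 / (3 * R))\<^sup>2"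
      by (intro power_mono) auto
    then show "norm (of_nat (m \<rho>) * (cnj \<rho> / (of_real (4 * R\<^sup>2) - cnj \<rho> * z0))\<^sup>2) \<le> real (m \<rho>) * (1 / (9 * R\<^sup>2))"
      unfolding norm_mult norm_power norm_of_nat
      by (intro mult_left_mono) (simp_all add: power2_eq_square)
  qed
  also have "\<dots> = real N / (9 * R\<^sup>2)" by (simp add: N_def sum_divide_distrib)
  also have "\<dots> \<le> 4 * (M + 1) / R\<^sup>2"
    using Nle M0 R by (simp add: divide_simps)
  finally have h3: "norm (\<Sum>\<rho>\<in>Z. of_nat (m \<rho>) * (cnj \<rho> / (of_real (4 * R\<^sup>2) - cnj \<rho> * z0))\<^sup>2)
    \<le> 4 * (M + 1) / R\<^sup>2" .
  have "96 * (M + 1) / R\<^sup>2 + 4 * (M + 1) / R\<^sup>2 = 100 * (M + 1) / R\<^sup>2"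
    by (simp add: add_divide_distrib[symmetric])
  with norm_triangle_le[OF add_mono[OF h2 h3]] show ?thesis unfolding eq by (simp only:)
qed

text \<open>Nonnegativity upgrades convergence along one exhaustion to unconditional summation:
  every finite subset of \<open>A\<close> lies in some \<open>Z n\<close>, so a bound for the
  sequence bounds all finite sums, and \<open>Z\<close> is cofinal among the finite subsets, which
  identifies the limit.\<close>

lemma nonneg_exhaustion_has_sum:
  fixes a :: "'a \<Rightarrow> real"
  assumes nn: "\<And>x. x \<in> A \<Longrightarrow> a x \<ge> 0" and fin: "\<And>n. finite (Z n)" and sub: "\<And>n::nat. Z n \<subseteq> A"
    and exh: "\<And>x. x \<in> A \<Longrightarrow> eventually (\<lambda>n. x \<in> Z n) sequentially"
    and lim: "(\<lambda>n. sum a (Z n)) \<longlonglongrightarrow> s"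
  shows "(a has_sum s) A"
proof -
  have ev: "eventually (\<lambda>n. X \<subseteq> Z n) sequentially" if "finite X" "X \<subseteq> A" for X
    using that exh by (auto simp: subset_iff eventually_ball_finite_distrib Ball_def[symmetric])
  have fl: "filterlim Z (finite_subsets_at_top A) sequentially"
    unfolding filterlim_finite_subsets_at_top using ev fin sub by auto
  obtain B where B: "\<And>n. sum a (Z n) \<le> B"
    using lim convergentI convergent_imp_Bseq Bseq_def by (metis abs_le_D1 real_norm_def)
  have "a summable_on A"
  proof (rule nonneg_bdd_above_summable_on[OF nn])
    show "bdd_above (sum a ` {F. F \<subseteq> A \<and> finite F})"
    proof (rule bdd_aboveI2)
      fix F assume "F \<in> {F. F \<subseteq> A \<and> finite F}"
      then have "finite F" "F \<subseteq> A" by auto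
      then obtain n where "F \<subseteq> Z n" using eventually_happens'[OF sequentially_bot ev] by metis
      then have "sum a F \<le> sum a (Z n)" using nn sub fin by (intro sum_mono2) auto
      then show "sum a F \<le> B" using B[of n] by simp
    qed
  qed
  then have hs: "(a has_sum infsum a A) A" by simp
  then have "(\<lambda>n. sum a (Z n)) \<longlonglongrightarrow> infsum a A"
    unfolding has_sum_def by (rule filterlim_compose[OF _ fl])
  then have "infsum a A = s" using lim LIMSEQ_unique by blast
  then show ?thesis using hs by simp
qed

text \<open>The radius runs through the integers n, with error 100 (phi(2n) + 1) / n^2. By
  \<open>line\<close> each difference z0 - rho is purely imaginary, so its square is minus a real
  square and the signs cancel. The second claim holds because \<open>D\<close> is a limit of real
  numbers; it lets the complex derivative \<open>D\<close> be replaced by the real sum.\<close>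

theorem entire_zeros_critical_line_has_sum:
  fixes f :: "complex \<Rightarrow> complex" and \<phi> :: "real \<Rightarrow> real"
  assumes f: "f holomorphic_on UNIV" and f0: "f 0 = 1"
    and growth: "\<And>w. norm (f w) \<le> exp (\<phi> (norm w))"
    and lim: "((\<lambda>R. \<phi> (2 * R) / R\<^sup>2) \<longlongrightarrow> 0) at_top"
    and line: "\<And>\<rho>. f \<rho> = 0 \<Longrightarrow> Re \<rho> = c"
    and nz: "f (of_real c + \<i> * of_real t) \<noteq> 0"
  defines "D \<equiv> deriv (\<lambda>z. deriv f z / f z) (of_real c + \<i> * of_real t)"
  shows "((\<lambda>\<rho>. of_int (zorder f \<rho>) / (t - Im \<rho>)\<^sup>2) has_sum Re D) {\<rho>. f \<rho> = 0}"
    and "D = complex_of_real (Re D)"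
proof -
  define z0 where "z0 = of_real c + \<i> * of_real t"
  define a where "a \<rho> = real_of_int (zorder f \<rho>) / (t - Im \<rho>)\<^sup>2" for \<rho>
  define Z where "Z n = {\<rho>. f \<rho> = 0 \<and> norm \<rho> \<le> real n}" for n
  have fin: "finite (Z n)" for n
    unfolding Z_def by (rule finite_entire_zeros_cball[OF f, of 0]) (simp add: f0)
  have zo: "zorder f \<rho> \<ge> 0" for \<rho>
  proof -
    have "\<exists>w\<in>UNIV. f w \<noteq> 0" using f0 by (intro bexI[of _ 0]) auto
    then show ?thesis
      using zorder_exist_zero[OF f open_UNIV connected_UNIV UNIV_I, of \<rho>] by (auto split: if_splits)
  qed
  have trm: "of_int (zorder f \<rho>) / (z0 - \<rho>)\<^sup>2 = - complex_of_real (a \<rho>)" if "f \<rho> = 0" for \<rho>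
  proof -
    have "z0 - \<rho> = \<i> * of_real (t - Im \<rho>)"
      using line[OF that] by (simp add: z0_def complex_eq_iff)
    then have "(z0 - \<rho>)\<^sup>2 = - of_real ((t - Im \<rho>)\<^sup>2)"
      by (simp add: power_mult_distrib)
    then show ?thesis by (simp add: a_def)
  qed
  have sumeq: "(\<Sum>\<rho>\<in>Z n. of_int (zorder f \<rho>) / (z0 - \<rho>)\<^sup>2) = - complex_of_real (sum a (Z n))" for n
    unfolding of_real_sum sum_negf[symmetric] by (intro sum.cong refl trm) (simp add: Z_def)
  have "(\<lambda>n. D - complex_of_real (sum a (Z n))) \<longlonglongrightarrow> 0"
  proof (rule Lim_null_comparison)
    \<comment> \<open>From here on the approximation applies with R = n: it asks for R > 0 and |z0|
      <= R/4.\<close>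
    have "eventually (\<lambda>n. real n \<ge> max 1 (4 * norm z0)) sequentially"
      using filterlim_real_sequentially unfolding filterlim_at_top by blast
    then show "eventually (\<lambda>n. norm (D - complex_of_real (sum a (Z n)))
        \<le> 100 * (\<phi> (2 * real n) / (real n)\<^sup>2 + 1 / (real n)\<^sup>2)) sequentially"
    proof eventually_elim
      case (elim n)
      have "norm (D + (\<Sum>\<rho>\<in>Z n. of_int (zorder f \<rho>) / (z0 - \<rho>)\<^sup>2)) \<le> 100 * (\<phi> (2 * real n) + 1) / (real n)\<^sup>2"
        unfolding D_def Z_def z0_def[symmetric]
      proof (rule entire_deriv_logderiv_approx[OF f f0])
        show "norm w = 2 * real n \<Longrightarrow> norm (f w) \<le> exp (\<phi> (2 * real n))" for w
          using growth[of w] by simp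
      qed (use elim nz in \<open>auto simp: z0_def\<close>)
      then show ?case unfolding sumeq by (simp add: add_divide_distrib)
    qed
    have "(\<lambda>n. \<phi> (2 * real n) / (real n)\<^sup>2) \<longlonglongrightarrow> 0"
      by (rule filterlim_compose[OF lim filterlim_real_sequentially])
    moreover have "(\<lambda>n. 1 / (real n)\<^sup>2) \<longlonglongrightarrow> 0" by real_asymp
    ultimately show "(\<lambda>n. 100 * (\<phi> (2 * real n) / (real n)\<^sup>2 + 1 / (real n)\<^sup>2)) \<longlonglongrightarrow> 0"
      by (intro tendsto_mult_right_zero tendsto_add_zero)
  qed
  from tendsto_diff[OF tendsto_const[of D] this]
  have l: "(\<lambda>n. complex_of_real (sum a (Z n))) \<longlonglongrightarrow> D" by simp
  have "(\<lambda>n. sum a (Z n)) \<longlonglongrightarrow> Re D" using tendsto_Re[OF l] by simp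
  then show "((\<lambda>\<rho>. of_int (zorder f \<rho>) / (t - Im \<rho>)\<^sup>2) has_sum Re D) {\<rho>. f \<rho> = 0}"
    unfolding a_def[symmetric]
  proof (rule nonneg_exhaustion_has_sum[rotated -1])
    show "eventually (\<lambda>n. x \<in> Z n) sequentially" if "x \<in> {\<rho>. f \<rho> = 0}" for x
    proof -
      have "eventually (\<lambda>n. real n \<ge> norm x) sequentially"
        using filterlim_real_sequentially unfolding filterlim_at_top by blast
      then show ?thesis by eventually_elim (use that in \<open>auto simp: Z_def\<close>)
    qed
  qed (use fin zo in \<open>auto simp: a_def Z_def\<close>)
  have "(\<lambda>n. Im (complex_of_real (sum a (Z n)))) \<longlonglongrightarrow> Im D" by (rule tendsto_Im[OF l])
  then have "Im D = 0" using LIMSEQ_unique[OF _ tendsto_const] by simp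
  then show "D = complex_of_real (Re D)" by (simp add: complex_eq_iff)
qed

section \<open>The theta transformation\<close>

text \<open>
  Chernoff's device: dividing \<open>F - F 0\<close> by \<open>exp (2 \<pi> \<i> z) - 1\<close> turns the symmetric partial sums
  of the Fourier coefficients into telescoping ones.
\<close>

lemma fourier_symmetric_sums:
  fixes F :: "complex \<Rightarrow> complex"
  assumes F: "F holomorphic_on UNIV"
  defines "c \<equiv> (\<lambda>k::int. integral {-(1/2)..1/2::real} (\<lambda>u. F (of_real u) * cis (-2 * pi * of_int k * u)))"
  shows "(\<lambda>N. \<Sum>k=-int N..int N. c k) \<longlonglongrightarrow> F 0"
proof -
  define I where "I = {-(1/2)..1/2::real}"
  define E where "E z = exp (2 * of_real pi * \<i> * z) - 1" for z :: complex
  \<comment> \<open>Numerator and denominator both vanish at 0, so a factor z is split off from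
    each. The zeros of \<open>E\<close> on the real line are the integers, and \<open>I\<close>
    contains only 0, hence \<open>q / r\<close> is smooth on the closed interval.\<close>
  define q where "q z = (if z = 0 then deriv (\<lambda>z. F z - F 0) 0 else (F z - F 0) / z)" for z
  define r where "r z = (if z = 0 then deriv E 0 else E z / z)" for z
  have Eh: "E holomorphic_on UNIV" unfolding E_def by (intro holomorphic_intros)
  have q: "q holomorphic_on UNIV"
    by (rule pole_theorem_0[where g = "\<lambda>z. F z - F 0" and a = 0])
       (use F in \<open>auto simp: q_def intro!: holomorphic_intros\<close>)
  have r: "r holomorphic_on UNIV"
    by (rule pole_theorem_0[where g = E and a = 0]) (use Eh in \<open>auto simp: r_def E_def\<close>)
  have dE: "deriv E 0 = 2 * of_real pi * \<i>"
    unfolding E_def by (rule DERIV_imp_deriv) (auto intro!: derivative_eq_intros)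
  have rnz: "r (of_real u) \<noteq> 0" if "u \<in> I" for u
  proof (cases "u = 0")
    case True then show ?thesis by (simp add: r_def dE)
  next
    case False
    have "E (of_real u) \<noteq> 0"
    proof
      assume "E (of_real u) = 0"
      then have "exp (2 * of_real pi * \<i> * of_real u) = (1::complex)" by (simp add: E_def)
      then obtain n :: int where "Im (2 * of_real pi * \<i> * of_real u :: complex) = of_int (2 * n) * pi"
        using exp_eq_1 by blast
      then have "u = of_int n" by simp
      then show False using that False by (auto simp: I_def) 
    qed
    then show ?thesis using False by (simp add: r_def)
  qed
  define g where "g u = q (of_real u) / r (of_real u)" for u :: real
  define g' where "g' u = (deriv q (of_real u) * r (of_real u) - q (of_real u) * deriv r (of_real u)) / (r (of_real u) * r (of_real u))" for u :: real
  have gd: "(g has_vector_derivative g' u) (at u)" if "u \<in> I" for u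
  proof -
    have "(q has_field_derivative deriv q (of_real u)) (at (of_real u))"
         "(r has_field_derivative deriv r (of_real u)) (at (of_real u))"
      using q r holomorphic_derivI[of _ UNIV] by auto
    then have "((\<lambda>z. q z / r z) has_field_derivative g' u) (at (of_real u))"
      unfolding g'_def by (rule DERIV_divide) (rule rnz[OF that])
    from has_vector_derivative_real_field[OF this] show ?thesis
      unfolding g_def .
  qed
  have co: "continuous_on A (\<lambda>u::real. h (of_real u))" if "h holomorphic_on UNIV" for h :: "complex \<Rightarrow> complex" and A
    by (rule continuous_on_compose2[OF holomorphic_on_imp_continuous_on[OF that]])
       (intro continuous_on_of_real continuous_on_id, simp)
  have q': "deriv q holomorphic_on UNIV" and r': "deriv r holomorphic_on UNIV"
    using q r by (auto intro: holomorphic_deriv)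
  have gc: "continuous_on I g'" unfolding g'_def
    by (intro continuous_on_divide continuous_on_diff continuous_on_mult co[OF q] co[OF r] co[OF q'] co[OF r'])
       (use rnz in auto)
  have gc0: "continuous_on I g" unfolding g_def
    by (intro continuous_on_divide co[OF q] co[OF r]) (use rnz in auto)
  have geq: "F (of_real u) - F 0 = g u * E (of_real u)" if "u \<in> I" for u
    using rnz[OF that] by (auto simp: g_def q_def r_def E_def)
  define e where "e k u = cis (-2 * pi * of_int k * u)" for k :: int and u
  have ec: "continuous_on A (e k)" for A k unfolding e_def by (intro continuous_intros)
  have ed: "((\<lambda>u. e k u) has_vector_derivative (of_real (-2 * pi * of_int k) * \<i> * e k u)) (at u)" for k u
  proof -
    have "((\<lambda>z. exp (\<i> * (of_real (-2 * pi * of_int k) * z))) has_field_derivative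
       exp (\<i> * (of_real (-2 * pi * of_int k) * of_real u)) * (\<i> * of_real (-2 * pi * of_int k))) (at (of_real u))"
      by (auto intro!: derivative_eq_intros)
    from has_vector_derivative_real_field[OF this]
    show ?thesis by (simp add: e_def cis_conv_exp mult_ac)
  qed
  define ch where "ch k = integral I (\<lambda>u. g u * e k u)" for k
  \<comment> \<open>The Riemann-Lebesgue lemma with a rate, by one integration by parts. The
    boundary terms remain, but they are bounded independently of \<open>k\<close> and divided by 2
    pi |k|.\<close>
  have ch_lim: "\<exists>C. \<forall>k. k \<noteq> 0 \<longrightarrow> norm (ch k) \<le> C / \<bar>of_int k\<bar>"
  proof -
    define C where "C = norm (g (1/2)) + norm (g (-(1/2))) + integral I (\<lambda>u. norm (g' u))"
    have "norm (ch k) \<le> C / \<bar>of_int k\<bar>" if k: "k \<noteq> 0" for k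
    proof -
      define w where "w = of_real (-2 * pi * of_int k) * \<i>"
      have w: "w \<noteq> 0" "norm w = 2 * pi * \<bar>of_int k\<bar>" using k by (auto simp: w_def norm_mult abs_mult)
      define y where "y = e k (1/2) * g (1/2) - e k (-(1/2)) * g (-(1/2)) - integral I (\<lambda>u. e k u * g' u)"
      have "((\<lambda>u. (w * e k u) * g u) has_integral y) I"
        unfolding I_def
      proof (rule integration_by_parts_interior[OF bounded_bilinear_mult, where f = "e k" and g = g and g' = g'])
        have "((\<lambda>u. e k u * g' u) has_integral integral I (\<lambda>u. e k u * g' u)) I"
          unfolding I_def
          by (intro integrable_integral integrable_continuous_real continuous_on_mult gc[unfolded I_def] ec)
        then show "((\<lambda>u. e k u * g' u) has_integral (e k (1/2) * g (1/2) - e k (-(1/2)) * g (-(1/2)) - y)) {-(1/2)..1/2}"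
          by (simp add: y_def I_def)
      qed (use gd gc0 ec ed in \<open>auto simp: I_def w_def\<close>)
      then have "((\<lambda>u. w * (g u * e k u)) has_integral y) I" by (simp add: mult_ac)
      then have "integral I (\<lambda>u. w * (g u * e k u)) = y" by (rule integral_unique)
      then have "w * ch k = g (1/2) * e k (1/2) - g (-(1/2)) * e k (-(1/2)) - integral I (\<lambda>u. g' u * e k u)"
        by (simp add: ch_def y_def mult_ac)
      from arg_cong[OF this, of norm]
      have "norm w * norm (ch k) = norm (g (1/2) * e k (1/2) - g (-(1/2)) * e k (-(1/2)) - integral I (\<lambda>u. g' u * e k u))"
        by (simp only: norm_mult)
      also have "\<dots> \<le> norm (g (1/2) * e k (1/2)) + norm (g (-(1/2)) * e k (-(1/2))) + norm (integral I (\<lambda>u. g' u * e k u))"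
        by (intro order_trans[OF norm_triangle_ineq4] add_right_mono norm_triangle_ineq4)
      also have "norm (integral I (\<lambda>u. g' u * e k u)) \<le> integral I (\<lambda>u. norm (g' u))"
      proof (rule integral_norm_bound_integral)
        show "(\<lambda>u. g' u * e k u) integrable_on I"
          unfolding I_def by (intro integrable_continuous_real continuous_on_mult gc[unfolded I_def] ec)
        show "(\<lambda>u. norm (g' u)) integrable_on I"
          unfolding I_def by (intro integrable_continuous_real continuous_on_norm gc[unfolded I_def])
        show "norm (g' u * e k u) \<le> norm (g' u)" for u by (simp add: norm_mult e_def)
      qed
      finally have "norm w * norm (ch k) \<le> C" by (simp add: C_def norm_mult e_def)
      then have 1: "2 * pi * (\<bar>of_int k\<bar> * norm (ch k)) \<le> C" using w by (simp add: mult_ac)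
      have "1 * (\<bar>of_int k\<bar> * norm (ch k)) \<le> 2 * pi * (\<bar>of_int k\<bar> * norm (ch k))"
        using pi_gt3 by (intro mult_right_mono) auto
      with 1 have "\<bar>of_int k\<bar> * norm (ch k) \<le> C" by linarith
      then show ?thesis using k by (simp add: field_simps)
    qed
    then show ?thesis by blast
  qed
  then obtain C where C: "\<And>k. k \<noteq> 0 \<Longrightarrow> norm (ch k) \<le> C / \<bar>of_int k\<bar>" by blast
  have e0: "integral I (e k) = (if k = 0 then 1 else 0)" for k
  proof (cases "k = 0")
    case True then show ?thesis by (simp add: e_def[abs_def] I_def)
  next
    case False
    define w where "w = of_real (-2 * pi * of_int k) * \<i>"
    have w: "w \<noteq> 0" using False by (auto simp: w_def)
    have "((\<lambda>u. w * e k u) has_integral (e k (1/2) - e k (-(1/2)))) {-(1/2)..1/2}"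
      by (rule fundamental_theorem_of_calculus)
         (simp, unfold w_def, rule has_vector_derivative_at_within[OF ed])
    moreover have "e k (1/2) = e k (-(1/2))"
    proof -
      have "e k (1/2) * cis (2 * pi * of_int k) = e k (-(1/2))"
        unfolding e_def cis_mult by (intro arg_cong[of _ _ cis]) (simp add: field_simps)
      then show ?thesis by (simp add: cis_multiple_2pi)
    qed
    ultimately have "integral I (\<lambda>u. w * e k u) = 0" unfolding I_def by (simp only: integral_unique diff_self)
    then have "w * integral I (e k) = 0" by simp
    then show ?thesis using w False by simp
  qed
  \<comment> \<open>Multiplication of \<open>e k\<close> by \<open>E\<close> gives
    \<open>e (k - 1) - e k\<close>, so F = F(0) + g E makes each coefficient a difference of
    neighbouring \<open>ch\<close>; the constant F(0) is seen by k = 0 alone.\<close>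
  have ck: "c k = (if k = 0 then F 0 else 0) + (ch (k - 1) - ch k)" for k
  proof -
    have "c k = integral I (\<lambda>u. F 0 * e k u + (g u * e (k - 1) u - g u * e k u))"
      unfolding c_def I_def[symmetric]
    proof (rule integral_cong)
      fix u assume u: "u \<in> I"
      have "E (of_real u) * e k u = e (k - 1) u - e k u"
      proof -
        have "exp (2 * of_real pi * \<i> * of_real u) = cis (2 * pi * u)"
          by (simp add: cis_conv_exp mult_ac)
        moreover have "cis (2 * pi * u) * e k u = e (k - 1) u"
          by (simp add: e_def cis_mult algebra_simps)
        ultimately show ?thesis by (simp add: E_def algebra_simps)
      qed
      moreover have "F (of_real u) = F 0 + g u * E (of_real u)" using geq[OF u] by (simp add: algebra_simps)
      then have "F (of_real u) * e k u = F 0 * e k u + g u * (E (of_real u) * e k u)"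
        by (simp add: algebra_simps)
      ultimately have "F (of_real u) * e k u = F 0 * e k u + g u * (e (k - 1) u - e k u)" by simp
      then show "F (of_real u) * cis (-2 * pi * of_int k * u) = F 0 * e k u + (g u * e (k - 1) u - g u * e k u)"
        unfolding e_def[of k, symmetric] by (simp add: right_diff_distrib)
    qed
    also have "\<dots> = integral I (\<lambda>u. F 0 * e k u) + (integral I (\<lambda>u. g u * e (k - 1) u) - integral I (\<lambda>u. g u * e k u))"
    proof -
      have *: "(\<lambda>u. F 0 * e k u) integrable_on I" "(\<lambda>u. g u * e k u) integrable_on I" for k
        unfolding I_def
        by (intro integrable_continuous_real continuous_on_mult continuous_on_const gc0[unfolded I_def] ec)+
      show ?thesis
        by (subst integral_add[OF *(1) integrable_diff[OF *(2) *(2)]]) (simp add: integral_diff[OF *(2) *(2)])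
    qed
    finally show ?thesis by (simp add: ch_def e0)
  qed
  have "(\<Sum>k=-int N..int N. c k) = F 0 + (ch (- int N - 1) - ch (int N))" for N
  proof (induction N)
    case 0 then show ?case by (simp add: ck)
  next
    case (Suc N)
    have "{-int (Suc N)..int (Suc N)} = insert (- int (Suc N)) (insert (int (Suc N)) {-int N..int N})" by auto
    then have "(\<Sum>k=-int (Suc N)..int (Suc N). c k) = c (- int (Suc N)) + (c (int (Suc N)) + (\<Sum>k=-int N..int N. c k))"
      by simp
    moreover have "c (- int (Suc N)) = ch (- int (Suc N) - 1) - ch (- int N - 1)"
    proof -
      have "- int (Suc N) = - int N - 1" "- int N - 1 \<noteq> 0" by auto
      then show ?thesis by (simp only: ck) simp
    qed
    moreover have "c (int (Suc N)) = ch (int N) - ch (int (Suc N))"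
    proof -
      have "int N = int (Suc N) - 1" "int (Suc N) \<noteq> 0" by auto
      then show ?thesis by (simp only: ck) simp
    qed
    ultimately show ?case using Suc.IH by (simp only:) simp
  qed
  moreover have "(\<lambda>N. ch (- int N - 1)) \<longlonglongrightarrow> 0"
  proof (rule Lim_null_comparison)
    show "eventually (\<lambda>N. norm (ch (- int N - 1)) \<le> C / (real N + 1)) sequentially"
    proof (intro always_eventually allI)
      fix N
      have "\<bar>real_of_int (- int N - 1)\<bar> = real N + 1" by simp
      then show "norm (ch (- int N - 1)) \<le> C / (real N + 1)" using C[of "- int N - 1"] by (simp add: add.commute)
    qed
    show "(\<lambda>N. C / (real N + 1)) \<longlonglongrightarrow> 0" by real_asymp
  qed
  moreover have "(\<lambda>N. ch (int N)) \<longlonglongrightarrow> 0"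
  proof (rule Lim_null_comparison)
    show "eventually (\<lambda>N. norm (ch (int N)) \<le> C / real N) sequentially"
      using eventually_gt_at_top[of 0]
    proof eventually_elim
      case (elim N)
      then show ?case using C[of "int N"] by simp
    qed
    show "(\<lambda>N. C / real N) \<longlonglongrightarrow> 0" by real_asymp
  qed
  ultimately show ?thesis using tendsto_add[OF tendsto_const[of "F 0"] tendsto_diff[of "\<lambda>N. ch (- int N - 1)" 0 _ "\<lambda>N. ch (int N)" 0]] by simp
qed

section \<open>Poisson summation for the Gaussian\<close>

text \<open>The substitution y = sqrt (2 pi x) u turns the integral into the characteristic function
  of the standard normal law at -2 pi s / sqrt (2 pi x).\<close>

lemma gaussian_fourier_integral:
  fixes x s :: real
  assumes x: "x > 0"
  shows "integrable lborel (\<lambda>u. of_real (exp (- pi * x * u\<^sup>2)) * cis (-2 * pi * s * u))"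
    and "(LBINT u. of_real (exp (- pi * x * u\<^sup>2)) * cis (-2 * pi * s * u)) = of_real (exp (- pi * s\<^sup>2 / x) / sqrt x)"
proof -
  define a where "a = sqrt (2 * pi * x)"
  define t where "t = -2 * pi * s / a"
  have a: "a > 0" "a\<^sup>2 = 2 * pi * x" using x by (auto simp: a_def)
  define f where "f y = complex_of_real (std_normal_density y) * cis (t * y)" for y
  have [measurable]: "(\<lambda>y. cis (t * y)) \<in> borel_measurable borel"
    by (intro borel_measurable_continuous_onI continuous_intros)
  have f_int: "integrable lborel f"
    unfolding f_def
    by (rule Bochner_Integration.integrable_bound[OF integrable_std_normal_moment[of 0]])
       (auto simp: norm_mult)
  have "char std_normal_distribution t = (LBINT y. f y)"
    unfolding char_def f_def by (subst integral_density) (auto simp: scaleR_conv_of_real cis_conv_exp)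
  then have I: "(LBINT y. f y) = of_real (exp (- t\<^sup>2 / 2))"
    by (simp add: char_std_normal_distribution)
  have feq: "f (a * u) = of_real (1 / sqrt (2 * pi)) * (of_real (exp (- pi * x * u\<^sup>2)) * cis (-2 * pi * s * u))" for u
    using a by (simp add: f_def t_def std_normal_density_def power_mult_distrib field_simps)
  have int: "integrable lborel (\<lambda>u. f (0 + a * u))"
    using f_int a by (subst lborel_integrable_real_affine_iff) auto
  show "integrable lborel (\<lambda>u. of_real (exp (- pi * x * u\<^sup>2)) * cis (-2 * pi * s * u))"
  proof -
    have "of_real (sqrt (2 * pi)) * f (0 + a * u) = of_real (exp (- pi * x * u\<^sup>2)) * cis (-2 * pi * s * u)" for u
      unfolding add_0 feq mult.assoc[symmetric] of_real_mult[symmetric] by simp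
    moreover have "integrable lborel (\<lambda>u. of_real (sqrt (2 * pi)) * f (0 + a * u))"
      using int by simp
    ultimately show ?thesis by (simp only:)
  qed
  have "(LBINT y. f y) = a *\<^sub>R (LBINT u. f (0 + a * u))"
    using lborel_integral_real_affine[of a f 0] a by simp
  also have "(LBINT u. f (0 + a * u)) = of_real (1 / sqrt (2 * pi)) *
      (LBINT u. of_real (exp (- pi * x * u\<^sup>2)) * cis (-2 * pi * s * u))"
    unfolding add_0 feq by (rule integral_mult_right_zero)
  finally have "of_real (sqrt x) * (LBINT u. of_real (exp (- pi * x * u\<^sup>2)) * cis (-2 * pi * s * u)) = of_real (exp (- t\<^sup>2 / 2))"
    unfolding I by (simp add: a_def real_sqrt_mult scaleR_conv_of_real)
  moreover have "t\<^sup>2 / 2 = pi * s\<^sup>2 / x"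
    using x a by (simp add: t_def power_divide power_mult_distrib) (simp add: power2_eq_square field_simps)
  ultimately have "of_real (sqrt x) * (LBINT u. of_real (exp (- pi * x * u\<^sup>2)) * cis (-2 * pi * s * u))
      = of_real (exp (- pi * s\<^sup>2 / x))" by simp
  then show "(LBINT u. of_real (exp (- pi * x * u\<^sup>2)) * cis (-2 * pi * s * u)) = of_real (exp (- pi * s\<^sup>2 / x) / sqrt x)"
    using x by (simp add: field_simps)
qed

text \<open>The terms k >= 1 of Jacobi's theta series over all integers k, which itself equals
  \<open>1 + 2 * jacobi_psi x\<close>. Leaving out the constant term gives exponential decay at
  infinity, as the Mellin integrals require.\<close>

definition jacobi_psi :: "real \<Rightarrow> real" where
  "jacobi_psi x = (\<Sum>n. exp (- pi * (real (Suc n))\<^sup>2 * x))"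

lemma jacobi_psi_terms_le: "x > 0 \<Longrightarrow> exp (- pi * (real (Suc n))\<^sup>2 * x) \<le> exp (- pi * x) * exp (- pi * x) ^ n"
proof -
  assume x: "x > 0"
  have "exp (- pi * x) * exp (- pi * x) ^ n = exp (- pi * x * real (Suc n))"
    by (simp add: exp_of_nat_mult[symmetric] exp_add[symmetric] algebra_simps)
  moreover have "real (Suc n) \<le> (real (Suc n))\<^sup>2" by (simp add: power2_eq_square)
  then have "pi * x * real (Suc n) \<le> pi * x * (real (Suc n))\<^sup>2"
    using x by (intro mult_left_mono) auto
  ultimately show ?thesis by (simp add: mult_ac)
qed

lemma summable_jacobi_psi: "x > 0 \<Longrightarrow> summable (\<lambda>n. exp (- pi * (real (Suc n))\<^sup>2 * x))"
proof (rule summable_comparison_test)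
  assume x: "x > 0"
  show "\<exists>N. \<forall>n\<ge>N. norm (exp (- pi * (real (Suc n))\<^sup>2 * x)) \<le> exp (- pi * x) * exp (- pi * x) ^ n"
    using jacobi_psi_terms_le[OF x] by (intro exI[of _ 0]) (simp del: of_nat_Suc)
  show "summable (\<lambda>n. exp (- pi * x) * exp (- pi * x) ^ n)"
    using x by (intro summable_mult summable_geometric) auto
qed

lemma jacobi_psi_sym_sums:
  assumes "x > 0"
  shows "(\<lambda>N. \<Sum>k=-int N..int N. exp (- pi * (of_int k)\<^sup>2 * x)) \<longlonglongrightarrow> 1 + 2 * jacobi_psi x"
proof -
  have "(\<Sum>k=-int N..int N. exp (- pi * (of_int k)\<^sup>2 * x)) = 1 + 2 * (\<Sum>n<N. exp (- pi * (real (Suc n))\<^sup>2 * x))" for N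
  proof (induction N)
    case (Suc N)
    have "{-int (Suc N)..int (Suc N)} = insert (- int (Suc N)) (insert (int (Suc N)) {-int N..int N})" by auto
    then show ?case using Suc.IH by (simp del: of_nat_Suc)
  qed auto
  moreover have "(\<lambda>N. 1 + 2 * (\<Sum>n<N. exp (- pi * (real (Suc n))\<^sup>2 * x))) \<longlonglongrightarrow> 1 + 2 * jacobi_psi x"
    unfolding jacobi_psi_def by (intro tendsto_intros summable_LIMSEQ summable_jacobi_psi assms)
  ultimately show ?thesis by simp
qed

text \<open>Poisson summation: \<open>F\<close> sums the Gaussian over all integer translates, and
  its Fourier coefficients unfold to Gaussian integrals over the whole line. F(0) is evaluated
  twice, as the sum of the coefficients and as the sum of the translates.\<close>

theorem jacobi_psi_transformation:
  assumes x: "x > 0"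
  shows "1 + 2 * jacobi_psi x = (1 + 2 * jacobi_psi (1 / x)) / sqrt x"
proof -
  define \<phi> where "\<phi> z = exp (- of_real (pi * x) * z\<^sup>2)" for z :: complex
  \<comment> \<open>Grouping the translates by n and -n makes the partial sums symmetric and
    \<open>F\<close> an ordinary series.\<close>
  define b where "b n z = (if n = 0 then \<phi> z else \<phi> (z + of_nat n) + \<phi> (z - of_nat n))" for n z
  define F where "F z = (\<Sum>n. b n z)" for z
  have part: "(\<Sum>n<Suc N. b n z) = (\<Sum>k=-int N..int N. \<phi> (z + of_int k))" for N z
  proof (induction N)
    case 0 show ?case by (simp add: b_def)
  next
    case (Suc N)
    have "{-int (Suc N)..int (Suc N)} = insert (- int (Suc N)) (insert (int (Suc N)) {-int N..int N})" by auto
    then have "(\<Sum>k=-int (Suc N)..int (Suc N). \<phi> (z + of_int k)) = \<phi> (z + of_int (- int (Suc N))) + (\<phi> (z + of_nat (Suc N)) + (\<Sum>k=-int N..int N. \<phi> (z + of_int k)))"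
      by simp
    moreover have "of_int (- int (Suc N)) = - (of_nat (Suc N) :: complex)" by simp
    moreover have "b (Suc N) z = \<phi> (z + of_nat (Suc N)) + \<phi> (z - of_nat (Suc N))" by (simp add: b_def)
    ultimately show ?case unfolding Suc.IH[symmetric] by (simp only: sum.lessThan_Suc[of _ "Suc N"] add_uminus_conv_diff add_ac)
  qed
  have ul: "uniform_limit (cball 0 r) (\<lambda>N z. \<Sum>n<N. b n z) F sequentially" for r
    unfolding F_def
  proof (rule Weierstrass_m_test_ev)
    \<comment> \<open>If |y| = n >= 2r + 1 and |Re z| <= r, then (Re z + y)^2 >= n^2 - 2rn >= n; the
      linear exponent yields a geometric majorant, and |Im z| <= r costs the factor exp (pi x
      r^2).\<close>
    have "eventually (\<lambda>n. real n \<ge> max 1 (2 * r + 1)) sequentially"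
      using filterlim_real_sequentially unfolding filterlim_at_top by blast
    then show "eventually (\<lambda>n. \<forall>z\<in>cball 0 r. norm (b n z) \<le> 2 * exp (pi * x * r\<^sup>2) * exp (- pi * x) ^ n) sequentially"
    proof (eventually_elim, intro ballI)
      fix n and z :: complex assume n: "max 1 (2 * r + 1) \<le> real n" and "z \<in> cball 0 r"
      then have z: "\<bar>Re z\<bar> \<le> r" "\<bar>Im z\<bar> \<le> r" using abs_Re_le_cmod[of z] abs_Im_le_cmod[of z] by auto
      have *: "norm (\<phi> (z + of_real y)) \<le> exp (pi * x * r\<^sup>2) * exp (- pi * x) ^ n" if "\<bar>y\<bar> = real n" for y
      proof -
        have "Re ((z + of_real y)\<^sup>2) = (Re z + y)\<^sup>2 - (Im z)\<^sup>2" by (simp add: power2_eq_square)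
        moreover have "(Im z)\<^sup>2 \<le> r\<^sup>2" using z(2) abs_le_square_iff[of "Im z" r] by auto
        moreover have "(Re z + y)\<^sup>2 \<ge> real n"
        proof -
          have "\<bar>Re z * y\<bar> \<le> r * real n" unfolding abs_mult using z that by (intro mult_mono) auto
          moreover have "y\<^sup>2 = (real n)\<^sup>2" using that by (metis power2_abs)
          moreover have "(2 * r + 1) * real n \<le> real n * real n" using n by (intro mult_right_mono) auto
          ultimately have "real n \<le> 2 * (Re z * y) + y\<^sup>2" by (simp add: power2_eq_square algebra_simps)
          also have "\<dots> \<le> (Re z)\<^sup>2 + (2 * (Re z * y) + y\<^sup>2)" by simp
          finally show ?thesis by (simp add: power2_sum mult_ac)
        qed
        ultimately have "real n - r\<^sup>2 \<le> Re ((z + of_real y)\<^sup>2)" by linarith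
        then have "pi * x * (real n - r\<^sup>2) \<le> pi * x * Re ((z + of_real y)\<^sup>2)"
          using x by (intro mult_left_mono) auto
        then have "- (pi * x * Re ((z + of_real y)\<^sup>2)) \<le> pi * x * r\<^sup>2 + real n * (- pi * x)"
          by (simp add: algebra_simps)
        then show ?thesis
          by (simp add: \<phi>_def norm_exp_eq_Re exp_of_nat_mult[symmetric] exp_add[symmetric] del: Re_power2)
      qed
      have "n \<noteq> 0" using n by auto
      then have "norm (b n z) \<le> norm (\<phi> (z + of_real (real n))) + norm (\<phi> (z + of_real (- real n)))"
        using norm_triangle_ineq by (simp add: b_def)
      then show "norm (b n z) \<le> 2 * exp (pi * x * r\<^sup>2) * exp (- pi * x) ^ n"
        using *[of "real n"] *[of "- real n"] by simp
    qed
    show "summable (\<lambda>n. 2 * exp (pi * x * r\<^sup>2) * exp (- pi * x) ^ n)"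
      using x by (intro summable_mult summable_geometric) auto
  qed
  have F: "F holomorphic_on UNIV"
  proof (rule holomorphic_uniform_sequence)
    show "(\<lambda>z. \<Sum>n<N. b n z) holomorphic_on UNIV" for N
    proof (rule holomorphic_on_sum)
      show "b n holomorphic_on UNIV" for n
        by (cases "n = 0") (auto simp: b_def[abs_def] \<phi>_def intro!: holomorphic_intros)
    qed
    show "\<exists>d>0. cball z d \<subseteq> UNIV \<and> uniform_limit (cball z d) (\<lambda>N z. \<Sum>n<N. b n z) F sequentially" for z
    proof (intro exI[of _ 1] conjI)
      show "uniform_limit (cball z 1) (\<lambda>N z. \<Sum>n<N. b n z) F sequentially"
        by (rule uniform_limit_on_subset[OF ul[of "norm z + 1"]])
           (auto simp: dist_norm norm_minus_commute intro!: order_trans[OF norm_triangle_sub[of _ z]])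
    qed auto
  qed simp
  define e where "e k u = cis (-2 * pi * of_int k * u)" for k :: int and u
  have ec: "continuous_on A (e k)" for A k unfolding e_def by (intro continuous_intros)
  have \<phi>c: "continuous_on A \<phi>" for A unfolding \<phi>_def by (intro continuous_intros)
  have \<phi>r: "\<phi> (of_real u) = of_real (exp (- pi * x * u\<^sup>2))" for u
    by (simp add: \<phi>_def exp_of_real[symmetric] of_real_power[symmetric] del: of_real_power)
  have coeff: "integral {-(1/2)..1/2::real} (\<lambda>u. F (of_real u) * e k u)
      = of_real (exp (- pi * (of_int k)\<^sup>2 * (1 / x)) / sqrt x)" for k
  proof -
    define h where "h u = \<phi> (of_real u) * e k u" for u
    have hc: "continuous_on A h" for A
      unfolding h_def by (intro continuous_intros ec continuous_on_compose2[OF \<phi>c]) auto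
    have h_int: "integrable lborel h" "(LBINT u. h u) = of_real (exp (- pi * (of_int k)\<^sup>2 / x) / sqrt x)"
      using gaussian_fourier_integral[OF x, of "of_int k"] by (simp_all add: h_def[abs_def] \<phi>r e_def)
    \<comment> \<open>Unfolding: the shifts of the unit interval by j = -N, ..., N tile
      [-N - 1/2, N + 1/2], and \<open>e k\<close> is invariant under integer shifts.\<close>
    have sum_eq: "integral {-(1/2)..1/2} (\<lambda>u. (\<Sum>n<Suc N. b n (of_real u)) * e k u)
        = integral {-(real N + 1/2)..real N + 1/2} h" for N
    proof -
      have per: "\<phi> (of_real u + of_int j) * e k u = h (u + of_int j)" for u j
      proof -
        have "e k (u + of_int j) = e k u * cis (2 * pi * of_int (- k * j))"
          unfolding e_def cis_mult by (intro arg_cong[of _ _ cis]) (simp add: algebra_simps)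
        also have "cis (2 * pi * of_int (- k * j)) = 1" by (rule cis_multiple_2pi) auto
        finally show ?thesis by (simp add: h_def)
      qed
      have sh: "integral {-(1/2)..1/2} (\<lambda>u. h (u + of_int j)) = integral {of_int j - 1/2..of_int j + 1/2} h" for j
        using integral_shift[of "-(1/2)" "of_int j" "1/2" h] hc by (simp add: o_def add_ac)
      have "integral {-(1/2)..1/2} (\<lambda>u. (\<Sum>n<Suc N. b n (of_real u)) * e k u)
         = integral {-(1/2)..1/2} (\<lambda>u. \<Sum>j=-int N..int N. h (u + of_int j))"
        unfolding part sum_distrib_right per ..
      also have "\<dots> = (\<Sum>j=-int N..int N. integral {-(1/2)..1/2} (\<lambda>u. h (u + of_int j)))"
        by (intro integral_sum integrable_continuous_real continuous_on_compose2[OF hc] continuous_intros) auto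
      also have "\<dots> = (\<Sum>j=-int N..int N. integral {of_int j - 1/2..of_int j + 1/2} h)"
        unfolding sh ..
      also have "\<dots> = integral {-(real N + 1/2)..real N + 1/2} h"
      proof (induction N)
        case 0 show ?case by simp
      next
        case (Suc N)
        have io: "h integrable_on {a..b}" for a b using hc by (rule integrable_continuous_real)
        have "integral {-(real (Suc N) + 1/2)..real (Suc N) + 1/2} h
            = integral {-(real (Suc N) + 1/2)..-(real N + 1/2)} h + integral {-(real N + 1/2)..real (Suc N) + 1/2} h"
          by (rule Henstock_Kurzweil_Integration.integral_combine[symmetric]) (auto intro: io)
        also have "integral {-(real N + 1/2)..real (Suc N) + 1/2} h =
            integral {-(real N + 1/2)..real N + 1/2} h + integral {real N + 1/2..real (Suc N) + 1/2} h"
          by (rule Henstock_Kurzweil_Integration.integral_combine[symmetric]) (auto intro: io)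
        finally have c: "integral {-(real (Suc N) + 1/2)..real (Suc N) + 1/2} h =
           integral {-(real (Suc N) + 1/2)..-(real N + 1/2)} h +
           (integral {real N + 1/2..real (Suc N) + 1/2} h + integral {-(real N + 1/2)..real N + 1/2} h)"
          by (simp only: add_ac)
        have eqs: "of_int (- int (Suc N)) - 1/2 = -(real (Suc N) + 1/2)" "of_int (- int (Suc N)) + 1/2 = -(real N + 1/2)"
          "of_int (int (Suc N)) - 1/2 = real N + 1/2" "of_int (int (Suc N)) + 1/2 = real (Suc N) + 1/2"
          by simp_all
        have "{-int (Suc N)..int (Suc N)} = insert (- int (Suc N)) (insert (int (Suc N)) {-int N..int N})" by auto
        then have "(\<Sum>j=-int (Suc N)..int (Suc N). integral {of_int j - 1/2..of_int j + 1/2} h) =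
            integral {of_int (- int (Suc N)) - 1/2..of_int (- int (Suc N)) + 1/2} h +
            (integral {of_int (int (Suc N)) - 1/2..of_int (int (Suc N)) + 1/2} h +
             (\<Sum>j=-int N..int N. integral {of_int j - 1/2..of_int j + 1/2} h))"
          by (simp del: of_nat_Suc of_int_of_nat_eq of_int_minus)
        then show ?case by (simp only: c Suc.IH eqs)
      qed
      finally show ?thesis .
    qed
    have "(\<lambda>N. integral {-(1/2)..1/2} (\<lambda>u. (\<Sum>n<Suc N. b n (of_real u)) * e k u))
        \<longlonglongrightarrow> integral {-(1/2)..1/2} (\<lambda>u. F (of_real u) * e k u)"
    proof -
      have "uniform_limit {-(1/2)..1/2::real} (\<lambda>N u. (\<Sum>n<N. b n (of_real u)) * e k u) (\<lambda>u. F (of_real u) * e k u) sequentially"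
      proof (rule uniform_lim_mult)
        show "uniform_limit {-(1/2)..1/2::real} (\<lambda>N u. \<Sum>n<N. b n (of_real u)) (\<lambda>u. F (of_real u)) sequentially"
          by (rule uniform_limit_compose'[OF ul[of 1]]) auto
        show "uniform_limit {-(1/2)..1/2::real} (\<lambda>N. e k) (e k) sequentially" by (rule uniform_limit_const)
        show "bounded ((\<lambda>u. F (of_real u)) ` {-(1/2)..1/2::real})"
          by (intro compact_imp_bounded compact_continuous_image compact_Icc
                continuous_on_compose2[OF holomorphic_on_imp_continuous_on[OF F]] continuous_on_of_real continuous_on_id) simp
        show "bounded (e k ` {-(1/2)..1/2::real})"
          by (intro compact_imp_bounded compact_continuous_image ec) auto
      qed
      then obtain I J where IJ: "\<And>N. ((\<lambda>u. (\<Sum>n<N. b n (of_real u)) * e k u) has_integral I N) {-(1/2)..1/2}"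
        "((\<lambda>u. F (of_real u) * e k u) has_integral J) {-(1/2)..1/2}" "I \<longlonglongrightarrow> J"
      proof (rule uniform_limit_integral)
        have bc: "continuous_on A (\<lambda>u. b n (of_real u))" for A n
        proof (cases "n = 0")
          case True
          then show ?thesis unfolding b_def
            by (simp, intro continuous_on_compose2[OF \<phi>c[of UNIV]] continuous_on_of_real continuous_on_id) simp
        next
          case False
          then show ?thesis unfolding b_def
            by (simp, intro continuous_on_add continuous_on_compose2[OF \<phi>c[of UNIV]] continuous_on_diff
                  continuous_on_const continuous_on_of_real continuous_on_id) simp_all
        qed
        show "continuous_on {-(1/2)..1/2} (\<lambda>u. (\<Sum>n<N. b n (of_real u)) * e k u)" for N
          by (intro continuous_intros bc ec)
      qed auto
      then show ?thesis
        using LIMSEQ_Suc[OF IJ(3)] integral_unique[OF IJ(1)] integral_unique[OF IJ(2)] by (simp only:)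
    qed
    then have 1: "(\<lambda>N. integral {-(real N + 1/2)..real N + 1/2} h) \<longlonglongrightarrow> integral {-(1/2)..1/2} (\<lambda>u. F (of_real u) * e k u)"
      unfolding sum_eq .
    \<comment> \<open>The truncated integrals have a second limit, the integral over the line, by
      dominated convergence; comparison with the first limit gives the coefficient.\<close>
    have "(\<lambda>N. LBINT u. indicator {-(real N + 1/2)..real N + 1/2} u *\<^sub>R h u) \<longlonglongrightarrow> (LBINT u. h u)"
    proof (rule integral_dominated_convergence[where w = "\<lambda>u. norm (h u)"])
      show "AE u in lborel. (\<lambda>N. indicator {-(real N + 1/2)..real N + 1/2} u *\<^sub>R h u) \<longlonglongrightarrow> h u"
      proof (intro AE_I2 tendsto_eventually)
        fix u :: real
        have "eventually (\<lambda>n. real n \<ge> \<bar>u\<bar>) sequentially"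
          using filterlim_real_sequentially unfolding filterlim_at_top by blast
        then show "eventually (\<lambda>N. indicator {-(real N + 1/2)..real N + 1/2} u *\<^sub>R h u = h u) sequentially"
          by eventually_elim (auto simp: indicator_def)
      qed
    qed (use h_int in \<open>auto simp: indicator_def\<close>)
    moreover have "(LBINT u. indicator {-(real N + 1/2)..real N + 1/2} u *\<^sub>R h u) = integral {-(real N + 1/2)..real N + 1/2} h" for N
      using set_borel_integral_eq_integral(2)[of "{-(real N + 1/2)..real N + 1/2}" h]
        integrable_mult_indicator[OF _ h_int(1)] by (simp add: set_lebesgue_integral_def set_integrable_def)
    ultimately have "(\<lambda>N. integral {-(real N + 1/2)..real N + 1/2} h) \<longlonglongrightarrow> (LBINT u. h u)" by simp
    from LIMSEQ_unique[OF 1 this] show ?thesis using h_int(2) by simp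
  qed
  have "(\<lambda>N. \<Sum>k=-int N..int N. of_real (exp (- pi * (of_int k)\<^sup>2 * (1 / x)) / sqrt x)) \<longlonglongrightarrow> F 0"
    using fourier_symmetric_sums[OF F] by (simp only: e_def[symmetric] coeff)
  moreover have "(\<lambda>N. of_real ((\<Sum>k=-int N..int N. exp (- pi * (of_int k)\<^sup>2 * (1 / x))) / sqrt x) :: complex) \<longlonglongrightarrow>
     of_real ((1 + 2 * jacobi_psi (1 / x)) / sqrt x)"
    using x by (intro tendsto_of_real tendsto_divide tendsto_const jacobi_psi_sym_sums) auto
  ultimately have A: "F 0 = of_real ((1 + 2 * jacobi_psi (1 / x)) / sqrt x)"
    using LIMSEQ_unique by (simp only: of_real_sum[symmetric] sum_divide_distrib)
  have "(\<lambda>N. \<Sum>n<N. b n 0) \<longlonglongrightarrow> F 0"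
    using tendsto_uniform_limitI[OF ul[of 1], of 0] by simp
  from LIMSEQ_Suc[OF this] have "(\<lambda>N. \<Sum>k=-int N..int N. \<phi> (of_int k)) \<longlonglongrightarrow> F 0"
    unfolding part by simp
  moreover have "\<phi> (of_int k) = of_real (exp (- pi * (of_int k)\<^sup>2 * x))" for k
    using \<phi>r[of "of_int k"] by (simp add: mult_ac)
  ultimately have "(\<lambda>N. of_real (\<Sum>k=-int N..int N. exp (- pi * (of_int k)\<^sup>2 * x)) :: complex) \<longlonglongrightarrow> F 0" by simp
  moreover have "(\<lambda>N. of_real (\<Sum>k=-int N..int N. exp (- pi * (of_int k)\<^sup>2 * x)) :: complex) \<longlonglongrightarrow> of_real (1 + 2 * jacobi_psi x)"
    by (intro tendsto_of_real jacobi_psi_sym_sums x)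
  ultimately have "F 0 = of_real (1 + 2 * jacobi_psi x)" using LIMSEQ_unique by blast
  then show ?thesis using A of_real_eq_iff by metis
qed

section \<open>The Riemann xi function\<close>

text \<open>Euler's integral after the substitution t = a exp u. In the logarithmic variable the
  inversion x -> 1/x of the theta transformation becomes u -> -u, so folding a Mellin integral is a
  reflection of Lebesgue measure on the line.\<close>

lemma Gamma_log_integral:
  fixes w :: complex and a :: real
  assumes w: "Re w > 0" and a: "a > 0"
  defines "f \<equiv> (\<lambda>u. of_real (exp (- a * exp u)) * exp (of_real u * w))"
  shows "integrable lborel f" and "(LBINT u. f u) = of_real a powr (- w) * Gamma w"
proof -
  define G where "G t = complex_of_real t powr (w - 1) / of_real (exp t)" for t
  define h where "h u = a * exp u" for u
  have im: "range h = {0<..}"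
  proof (intro equalityI subsetI)
    fix t :: real assume "t \<in> {0<..}"
    then have "h (ln (t / a)) = t" using a by (simp add: h_def)
    then show "t \<in> range h" by (metis rangeI)
  qed (use a in \<open>auto simp: h_def\<close>)
  have eq: "\<bar>h u\<bar> *\<^sub>R G (h u) = of_real a powr w * f u" for u
  proof -
    have pos: "h u > 0" using a by (simp add: h_def)
    have "of_real (h u) powr (w - 1) = of_real (h u) powr w / of_real (h u)"
      using pos by (simp add: powr_diff)
    moreover have "of_real (h u) powr w = of_real a powr w * (exp (of_real u * w) :: complex)"
    proof -
      have "of_real (h u) powr w = exp (w * of_real (ln (h u)))"
        using pos by (simp add: powr_def Ln_of_real)
      also have "ln (h u) = ln a + u" using a by (simp add: h_def ln_mult)
      finally show ?thesis using a by (simp add: powr_def Ln_of_real exp_add[symmetric] algebra_simps)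
    qed
    ultimately have "\<bar>h u\<bar> *\<^sub>R G (h u) = of_real a powr w * exp (of_real u * w) / of_real (exp (h u))"
      using pos by (simp add: G_def scaleR_conv_of_real)
    moreover have "1 / of_real (exp (h u)) = (of_real (exp (- a * exp u)) :: complex)"
      by (simp add: h_def exp_minus field_simps)
    ultimately show ?thesis unfolding f_def
      by (metis (no_types, opaque_lifting) divide_inverse inverse_eq_divide mult.assoc mult.commute)
  qed
  have "G absolutely_integrable_on range h \<and> integral (range h) G = Gamma w"
    unfolding im G_def using absolutely_integrable_Gamma_integral'[OF w] Gamma_integral_complex'[OF w]
    by (auto simp: integral_unique)
  moreover have "(h has_field_derivative h u) (at u within UNIV)" for u
    unfolding h_def by (auto intro!: derivative_eq_intros)
  moreover have "inj h" using a by (auto simp: h_def inj_on_def)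
  ultimately have "(\<lambda>u. \<bar>h u\<bar> *\<^sub>R G (h u)) absolutely_integrable_on UNIV \<and>
      integral UNIV (\<lambda>u. \<bar>h u\<bar> *\<^sub>R G (h u)) = Gamma w"
    by (subst has_absolute_integral_change_of_variables_real) auto
  then have ai: "(\<lambda>u. of_real a powr w * f u) absolutely_integrable_on UNIV"
    and ii: "integral UNIV (\<lambda>u. of_real a powr w * f u) = Gamma w" by (simp_all add: eq)
  have nz: "of_real a powr w \<noteq> 0" using a by auto
  have fm: "f \<in> borel_measurable lborel"
    unfolding f_def by (intro borel_measurable_continuous_onI continuous_intros | simp)+
  have "integrable lebesgue (\<lambda>u. of_real a powr w * f u)"
    using ai by (simp add: set_integrable_def)
  then have "integrable lborel (\<lambda>u. of_real a powr w * f u)"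
    using fm by (subst (asm) integrable_completion) auto
  then have "integrable lborel (\<lambda>u. inverse (of_real a powr w) * (of_real a powr w * f u))"
    by (rule integrable_mult_right)
  then show *: "integrable lborel f" using nz by (simp add: mult.assoc[symmetric])
  have "of_real a powr w * (LBINT u. f u) = (LINT u|lebesgue. of_real a powr w * f u)"
    using fm by (subst integral_completion) auto
  also have "\<dots> = Gamma w"
    using set_lebesgue_integral_eq_integral(2)[OF ai] unfolding ii by (simp add: set_lebesgue_integral_def)
  finally show "(LBINT u. f u) = of_real a powr (- w) * Gamma w"
    using nz by (simp add: powr_minus field_simps)
qed

text \<open>Supplies the polar terms 1/(w - 1/2) and 1/w that the constant term of the theta
  function produces when the integral is folded.\<close>

lemma exp_half_line_integral:
  fixes c :: complex
  assumes c: "Re c > 0"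
  defines "f \<equiv> (\<lambda>u::real. indicator {0<..} u *\<^sub>R exp (- (of_real u * c)))"
  shows "integrable lborel f" and "(LBINT u. f u) = 1 / c"
proof -
  have "(\<lambda>u. exp (- Re c * u)) absolutely_integrable_on {0..}"
    by (intro nonnegative_absolutely_integrable_1 integrable_on_exp_minus_to_infinity) (use c in auto)
  then have "integrable lebesgue (\<lambda>u. indicator {0..} u *\<^sub>R exp (- Re c * u))"
    by (simp add: set_integrable_def)
  then have r: "integrable lborel (\<lambda>u. indicator {0..} u *\<^sub>R exp (- Re c * u))"
    by (subst (asm) integrable_completion) auto
  have [measurable]: "(\<lambda>u. exp (- (of_real u * c))) \<in> borel_measurable borel"
    by (intro borel_measurable_continuous_onI continuous_intros)
  show fi: "integrable lborel f" unfolding f_def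
    by (rule Bochner_Integration.integrable_bound[OF r]) (auto simp: indicator_def norm_exp_eq_Re mult_ac)
  have "(\<lambda>N. LBINT u. indicator {0..real N} u *\<^sub>R exp (- (of_real u * c))) \<longlonglongrightarrow> (LBINT u. f u)"
  proof (rule integral_dominated_convergence[OF _ _ r])
    \<comment> \<open>The intervals [0, N] exhaust the closed half-line, \<open>f\<close> lives on
      the open one; the difference is the null set {0}.\<close>
    show "AE u in lborel. (\<lambda>N. indicator {0..real N} u *\<^sub>R exp (- (of_real u * c))) \<longlonglongrightarrow> f u"
      using AE_lborel_singleton[of 0]
    proof eventually_elim
      case (elim u)
      have "eventually (\<lambda>n. real n \<ge> \<bar>u\<bar>) sequentially"
        using filterlim_real_sequentially unfolding filterlim_at_top by blast
      then have "eventually (\<lambda>N. indicator {0..real N} u *\<^sub>R exp (- (of_real u * c)) = f u) sequentially"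
        by eventually_elim (use elim in \<open>auto simp: indicator_def f_def\<close>)
      then show ?case by (rule tendsto_eventually)
    qed
  qed (auto simp: indicator_def norm_exp_eq_Re mult_ac f_def)
  moreover have "(LBINT u. indicator {0..real N} u *\<^sub>R exp (- (of_real u * c))) = (1 - exp (- (of_real (real N) * c))) / c" for N
  proof -
    have cont: "continuous_on {0..real N} (\<lambda>u. exp (- (of_real u * c)))" by (intro continuous_intros)
    have "set_integrable lborel {0..real N} (\<lambda>u. exp (- (of_real u * c)))"
      by (rule borel_integrable_compact[OF compact_Icc cont, folded set_integrable_def])
    then have "(LBINT u. indicator {0..real N} u *\<^sub>R exp (- (of_real u * c))) = integral {0..real N} (\<lambda>u. exp (- (of_real u * c)))"
      using set_borel_integral_eq_integral(2)[of "{0..real N}"] by (simp add: set_lebesgue_integral_def)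
    also have "\<dots> = - exp (- (of_real (real N) * c)) / c - (- exp (- (of_real 0 * c)) / c)"
    proof (rule integral_unique, rule fundamental_theorem_of_calculus)
      fix u :: real
      have "((\<lambda>z. - exp (- (z * c)) / c) has_field_derivative exp (- (of_real u * c))) (at (of_real u))"
        using c by (auto intro!: derivative_eq_intros)
      from has_vector_derivative_real_field[OF this]
      show "((\<lambda>u. - exp (- (of_real u * c)) / c) has_vector_derivative exp (- (of_real u * c))) (at u within {0..real N})"
        by (rule has_vector_derivative_at_within)
    qed simp
    finally show ?thesis by (simp add: diff_divide_distrib)
  qed
  moreover have "(\<lambda>N. (1 - exp (- (of_real (real N) * c))) / c) \<longlonglongrightarrow> (1 - 0) / c"
  proof (intro tendsto_divide tendsto_diff tendsto_const)
    have "(\<lambda>N. exp (- Re c * real N)) \<longlonglongrightarrow> 0" using c by real_asymp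
    then show "(\<lambda>N. exp (- (of_real (real N) * c))) \<longlonglongrightarrow> 0"
      by (subst tendsto_norm_zero_iff[symmetric]) (simp add: norm_exp_eq_Re mult_ac)
  qed (use c in auto)
  ultimately show "(LBINT u. f u) = 1 / c" using LIMSEQ_unique by simp
qed

section \<open>The theta tail and its half-line Mellin transform\<close>

definition psi_exp :: "real \<Rightarrow> real" where
  "psi_exp u = jacobi_psi (exp u)"

lemma borel_measurable_psi_exp [measurable]: "psi_exp \<in> borel_measurable borel"
  unfolding psi_exp_def[abs_def] jacobi_psi_def by measurable

lemma psi_exp_nonneg: "psi_exp u \<ge> 0"
  unfolding psi_exp_def jacobi_psi_def by (intro suminf_nonneg summable_jacobi_psi) auto

text \<open>Comparison with a geometric series of ratio q = exp (- pi exp u). Since pi exp u >= 1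
  and e >= 2, q is at most 1/2 and q / (1 - q) <= 2q.\<close>

lemma psi_exp_le: "u \<ge> 0 \<Longrightarrow> psi_exp u \<le> 2 * exp (- pi * exp u)"
proof -
  assume u: "u \<ge> 0"
  define q where "q = exp (- pi * exp u)"
  have "exp 1 \<le> exp (pi * exp u)" using u pi_gt3 mult_mono[of 1 pi 1 "exp u"] by simp
  moreover have "2 \<le> exp (1::real)" using exp_ge_add_one_self[of 1] by simp
  ultimately have "2 \<le> exp (pi * exp u)" by linarith
  then have q: "0 < q" "q \<le> 1 / 2" by (auto simp: q_def exp_minus field_simps)
  have "psi_exp u \<le> (\<Sum>n. q * q ^ n)"
    unfolding psi_exp_def jacobi_psi_def q_def
    by (intro suminf_le jacobi_psi_terms_le summable_jacobi_psi summable_mult summable_geometric) auto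
  also have "\<dots> = q / (1 - q)" using q by (simp add: suminf_mult suminf_geometric summable_geometric)
  also have "\<dots> \<le> 2 * q" using q by (simp add: field_simps)
  finally show ?thesis by (simp add: q_def)
qed

text \<open>The theta transformation at x = exp (-u), solved for the value on the reflected
  half-line.\<close>

lemma psi_exp_reflect: "psi_exp (- u) = exp (u / 2) * psi_exp u + (exp (u / 2) - 1) / 2"
proof -
  have sq: "sqrt (exp (- u)) = exp (- u / 2)"
    by (rule real_sqrt_unique) (simp_all add: power2_eq_square exp_add[symmetric])
  have inv: "1 / exp (- x) = exp x" for x :: real
    using exp_minus_inverse[of x] by (simp only: nonzero_divide_eq_eq exp_not_eq_zero simp_thms)
  with sq have "1 / sqrt (exp (- u)) = exp (u / 2)"
    by (simp only: minus_divide_left[symmetric])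
  moreover have "1 + 2 * psi_exp (- u) = (1 + 2 * jacobi_psi (1 / exp (- u))) * (1 / sqrt (exp (- u)))"
    unfolding psi_exp_def using jacobi_psi_transformation[of "exp (- u)"] by simp
  moreover note inv[of u]
  ultimately have "1 + 2 * psi_exp (- u) = (1 + 2 * psi_exp u) * exp (u / 2)"
    by (simp only: psi_exp_def)
  then show ?thesis by (simp add: field_simps)
qed

text \<open>The source of the growth exponent 3/2. If u <= 3 sqrt b, the last term alone suffices.
  Otherwise 9b <= u^2, so u b <= u^3 / 9 = 3 (u/3)^3 <= pi exp u, by u/3 <= exp (u/3) and pi >
  3.\<close>

lemma double_exp_bound:
  fixes u b :: real
  assumes "u \<ge> 0" "b \<ge> 0"
  shows "u * b \<le> pi * exp u + 3 * (b * sqrt b)"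
proof (cases "u \<le> 3 * sqrt b")
  case True
  then have "u * b \<le> 3 * sqrt b * b" using assms by (intro mult_right_mono) auto
  moreover have "0 \<le> pi * exp u" by simp
  ultimately show ?thesis using mult.commute[of b "sqrt b"] by linarith
next
  case False
  then have "(3 * sqrt b)\<^sup>2 \<le> u\<^sup>2" using assms by (intro power_mono) auto
  then have "9 * b \<le> u\<^sup>2" using assms by (simp add: power_mult_distrib)
  then have 1: "u * (9 * b) \<le> u * u\<^sup>2" using assms by (intro mult_left_mono) auto
  have "(u / 3) ^ 3 \<le> exp (u / 3) ^ 3"
  proof (rule power_mono)
    show "u / 3 \<le> exp (u / 3)" using exp_ge_add_one_self[of "u / 3"] by linarith
  qed (use assms in auto)
  also have "exp (u / 3) ^ 3 = exp u" by (simp add: exp_of_nat_mult[symmetric])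
  finally have 2: "(u / 3) ^ 3 \<le> exp u" .
  have 3: "3 * (u / 3) ^ 3 \<le> pi * exp u"
    using pi_gt3 2 assms by (intro mult_mono) auto
  have "b * sqrt b \<ge> 0" using assms by simp
  with 1 3 show ?thesis by (simp add: power3_eq_cube power2_eq_square)
qed

definition psi_mellin :: "complex \<Rightarrow> complex" where
  "psi_mellin w = (LBINT u. indicator {0<..} u *\<^sub>R (of_real (psi_exp u) * exp (of_real u * w)))"

lemma psi_exp_bound:
  fixes u r :: real
  assumes "u \<ge> 0" "r \<ge> 0"
  shows "psi_exp u * exp (u * r) \<le> 2 * exp (3 * ((r + 1) * sqrt (r + 1))) * exp (- u)"
proof -
  have "psi_exp u * exp (u * r) \<le> 2 * exp (- pi * exp u) * exp (u * r)"
    using psi_exp_le[OF assms(1)] by (intro mult_right_mono) auto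
  \<comment> \<open>Writing u r as u (r + 1) - u saves a factor exp (-u), which keeps the majorant
    integrable.\<close>
  also have "\<dots> = 2 * exp (u * (r + 1) - pi * exp u - u)"
    by (simp add: exp_add[symmetric] algebra_simps)
  also have "\<dots> \<le> 2 * exp (3 * ((r + 1) * sqrt (r + 1)) - u)"
    using double_exp_bound[of u "r + 1"] assms by simp
  also have "\<dots> = 2 * exp (3 * ((r + 1) * sqrt (r + 1))) * exp (- u)"
    by (simp add: exp_add[symmetric])
  finally show ?thesis .
qed

lemma exp_minus_half_line:
  "integrable lborel (\<lambda>u::real. indicator {0<..} u *\<^sub>R exp (- u))"
  "(LBINT u::real. indicator {0<..} u *\<^sub>R exp (- u)) = 1"
proof -
  have eq: "indicator {0<..} u *\<^sub>R exp (- (complex_of_real u * 1)) = of_real (indicator {0<..} u *\<^sub>R exp (- u))" for u :: real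
    by (simp add: exp_of_real[symmetric] scaleR_conv_of_real)
  show "integrable lborel (\<lambda>u::real. indicator {0<..} u *\<^sub>R exp (- u))"
    using exp_half_line_integral(1)[of 1] unfolding eq by (simp only: complex_of_real_integrable_eq) simp
  have "complex_of_real (LBINT u::real. indicator {0<..} u *\<^sub>R exp (- u)) = 1"
    using exp_half_line_integral(2)[of 1] unfolding eq by (simp only: integral_complex_of_real) simp
  then show "(LBINT u::real. indicator {0<..} u *\<^sub>R exp (- u)) = 1" by simp
qed

lemma psi_mellin_integrand:
  fixes w :: complex
  defines "f \<equiv> (\<lambda>u. indicator {0<..} u *\<^sub>R (of_real (psi_exp u) * exp (of_real u * w)))"
  shows "integrable lborel f"
    and "norm (psi_mellin w) \<le> 2 * exp (3 * ((norm w + 1) * sqrt (norm w + 1)))"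
proof -
  define C where "C = 2 * exp (3 * ((norm w + 1) * sqrt (norm w + 1)))"
  have [measurable]: "(\<lambda>u. exp (of_real u * w)) \<in> borel_measurable borel"
    by (intro borel_measurable_continuous_onI continuous_intros)
  have g: "integrable lborel (\<lambda>u::real. C * (indicator {0<..} u *\<^sub>R exp (- u)))"
    using exp_minus_half_line(1) by (rule integrable_mult_right)
  have bd: "norm (f u) \<le> C * (indicator {0<..} u *\<^sub>R exp (- u))" for u
  proof (cases "u > 0")
    case True
    have "u * Re w \<le> u * norm w" using True complex_Re_le_cmod[of w] by (intro mult_left_mono) auto
    then have "psi_exp u * exp (u * Re w) \<le> psi_exp u * exp (u * norm w)"
      using psi_exp_nonneg by (intro mult_left_mono) auto
    also have "\<dots> \<le> C * exp (- u)" unfolding C_def using True by (intro psi_exp_bound) auto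
    finally show ?thesis using True psi_exp_nonneg[of u] by (simp add: f_def norm_mult norm_exp_eq_Re)
  qed (simp add: f_def)
  show i: "integrable lborel f"
  proof (rule Bochner_Integration.integrable_bound[OF g])
    show "f \<in> borel_measurable lborel" unfolding f_def by measurable
    show "AE u in lborel. norm (f u) \<le> norm (C * (indicator {0<..} u *\<^sub>R exp (- u)))"
      by (intro AE_I2 order_trans[OF bd]) (simp only: real_norm_def abs_ge_self)
  qed
  have "norm (LBINT u. f u) \<le> (LBINT u. norm (f u))" by (rule integral_norm_bound)
  also have "\<dots> \<le> (LBINT u. C * (indicator {0<..} u *\<^sub>R exp (- u)))"
    using i g bd by (intro integral_mono) auto
  also have "\<dots> = C" using exp_minus_half_line(2) by simp
  finally show "norm (psi_mellin w) \<le> 2 * exp (3 * ((norm w + 1) * sqrt (norm w + 1)))"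
    by (simp add: psi_mellin_def f_def C_def)
qed

text \<open>Instead of differentiating under the integral sign, exp (u w) is expanded and integrated
  term by term, giving a power series at 0 that converges everywhere. The integrand at the real
  point |w| dominates the partial sums of the absolute values.\<close>

lemma holomorphic_psi_mellin: "psi_mellin holomorphic_on UNIV"
proof -
  define a where "a k = (LBINT u. indicator {0<..} u *\<^sub>R (complex_of_real (psi_exp u) * (of_real u ^ k /\<^sub>R fact k)))" for k
  have "(\<lambda>k. a k * (w - 0) ^ k) sums psi_mellin w" for w
  proof -
    define f where "f k u = indicator {0<..} u *\<^sub>R (complex_of_real (psi_exp u) * ((of_real u * w) ^ k /\<^sub>R fact k))" for k u
    define g where "g u = indicator {0<..} u *\<^sub>R (complex_of_real (psi_exp u) * exp (of_real u * of_real (norm w)))" for u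
    have gi: "integrable lborel g" unfolding g_def by (rule psi_mellin_integrand)
    then have gi': "integrable lborel (\<lambda>u. norm (g u))" by (rule integrable_norm)
    have ng: "norm (g u) = indicator {0<..} u * (psi_exp u * exp (u * norm w))" for u
      using psi_exp_nonneg[of u] by (simp add: g_def norm_mult norm_exp_eq_Re)
    have nf: "norm (f k u) = indicator {0<..} u * (psi_exp u * ((u * norm w) ^ k /\<^sub>R fact k))" for k u
      using psi_exp_nonneg[of u] by (auto simp: f_def norm_mult norm_power power_mult_distrib indicator_def)
    have fm: "f k \<in> borel_measurable lborel" for k unfolding f_def by measurable
    have part: "(\<Sum>k<n. norm (f k u)) \<le> norm (g u)" for n u
    proof (cases "u > 0")
      case True
      have "(\<Sum>k<n. (u * norm w) ^ k /\<^sub>R fact k) \<le> exp (u * norm w)"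
        using True exp_converges[of "u * norm w"]
        by (intro sum_le_suminf[THEN order_trans]) (auto simp: sums_iff exp_def)
      then have "psi_exp u * (\<Sum>k<n. (u * norm w) ^ k /\<^sub>R fact k) \<le> psi_exp u * exp (u * norm w)"
        using psi_exp_nonneg by (intro mult_left_mono) auto
      then show ?thesis unfolding nf ng using True by (simp add: sum_distrib_left)
    qed (simp add: nf ng)
    have fi: "integrable lborel (f k)" for k
    proof (rule Bochner_Integration.integrable_bound[OF gi' fm], rule AE_I2)
      fix u
      have "norm (f k u) \<le> (\<Sum>k<Suc k. norm (f k u))" by (simp add: sum_nonneg)
      also have "\<dots> \<le> norm (g u)" by (rule part)
      finally show "norm (f k u) \<le> norm (norm (g u))" by simp
    qed
    have s: "(\<lambda>k. LBINT u. f k u) sums (LBINT u. (\<Sum>k. f k u))"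
    proof (rule sums_integral[OF fi])
      show "AE u in lborel. summable (\<lambda>k. norm (f k u))"
      proof (rule AE_I2)
        fix u
        show "summable (\<lambda>k. norm (f k u))"
          by (rule bounded_imp_summable[where B = "norm (g u)"])
             (simp_all only: lessThan_Suc_atMost[symmetric] part norm_ge_zero)
      qed
      show "summable (\<lambda>k. LBINT u. norm (f k u))"
      proof (rule bounded_imp_summable)
        show "(\<Sum>k\<le>n. LBINT u. norm (f k u)) \<le> (LBINT u. norm (g u))" for n
        proof -
          have "(\<Sum>k\<le>n. LBINT u. norm (f k u)) = (LBINT u. (\<Sum>k\<le>n. norm (f k u)))"
            using fi by (subst Bochner_Integration.integral_sum) auto
          also have "\<dots> \<le> (LBINT u. norm (g u))"
          proof (rule integral_mono)
            show "(\<Sum>k\<le>n. norm (f k u)) \<le> norm (g u)" for u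
              using part[where n = "Suc n" and u = u] by (simp only: lessThan_Suc_atMost)
          qed (use fi gi in auto)
          finally show ?thesis .
        qed
      qed auto
    qed
    have sf: "(\<Sum>k. f k u) = indicator {0<..} u *\<^sub>R (of_real (psi_exp u) * exp (of_real u * w))" for u
    proof -
      have "(\<lambda>k. indicator {0<..} u *\<^sub>R (complex_of_real (psi_exp u) * ((of_real u * w) ^ k /\<^sub>R fact k)))
        sums (indicator {0<..} u *\<^sub>R (of_real (psi_exp u) * exp (of_real u * w)))"
        by (intro sums_scaleR_right sums_mult exp_converges)
      then show ?thesis by (simp add: f_def sums_iff)
    qed
    have "(LBINT u. f k u) = a k * w ^ k" for k
    proof -
      have "f k u = (indicator {0<..} u *\<^sub>R (complex_of_real (psi_exp u) * (of_real u ^ k /\<^sub>R fact k))) * w ^ k" for u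
        by (simp add: f_def power_mult_distrib scaleR_conv_of_real)
      then show ?thesis unfolding a_def by (simp only: integral_mult_left_zero)
    qed
    then show ?thesis using s by (simp add: sf psi_mellin_def)
  qed
  then have ball: "psi_mellin holomorphic_on ball 0 r" for r by (intro power_series_holomorphic)
  show ?thesis
    unfolding holomorphic_on_def
  proof
    fix z :: complex
    have "psi_mellin field_differentiable (at z)"
      by (rule holomorphic_on_imp_differentiable_at[OF ball[of "norm z + 1"] open_ball]) simp
    then show "psi_mellin field_differentiable (at z within UNIV)" by simp
  qed
qed

text \<open>Termwise integration of the theta series. The norms of the terms integrate to a constant
  times n^(-2 Re w), summable because Re w > 1/2.\<close>

lemma psi_exp_full_mellin:
  assumes w: "Re w > 1 / 2"
  defines "g \<equiv> (\<lambda>u. of_real (psi_exp u) * exp (of_real u * w))"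
  shows "integrable lborel g"
    and "(\<lambda>n. of_real (pi * (real (Suc n))\<^sup>2) powr (- w) * Gamma w) sums (LBINT u. g u)"
proof -
  define a where "a n = pi * (real (Suc n))\<^sup>2" for n
  have a: "a n > 0" for n by (simp add: a_def)
  define f where "f n u = complex_of_real (exp (- a n * exp u)) * exp (of_real u * w)" for n u
  have w0: "Re w > 0" using w by simp
  have fi: "integrable lborel (f n)" "(LBINT u. f n u) = of_real (a n) powr (- w) * Gamma w" for n
    using Gamma_log_integral[OF w0 a[of n]] by (simp_all add: f_def[abs_def])
  \<comment> \<open>The norm of the integrand is the same integrand at Re w, so the Gamma integral
    also evaluates the integral of the norm.\<close>
  have nf: "complex_of_real (norm (f n u)) = of_real (exp (- a n * exp u)) * exp (of_real u * of_real (Re w))" for n u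
    by (simp add: f_def norm_mult norm_exp_eq_Re exp_of_real[symmetric])
  have nfi: "(LBINT u. norm (f n u)) = a n powr (- Re w) * Gamma (Re w)" for n
  proof -
    have "complex_of_real (LBINT u. norm (f n u)) = (LBINT u. complex_of_real (norm (f n u)))"
      by (rule integral_complex_of_real[symmetric])
    also have "\<dots> = of_real (a n) powr (- of_real (Re w)) * Gamma (of_real (Re w))"
      unfolding nf using Gamma_log_integral(2)[of "of_real (Re w)" "a n"] w0 a[of n] by simp
    also have "\<dots> = of_real (a n powr (- Re w) * Gamma (Re w))"
      using a[of n] by (simp add: powr_of_real[symmetric] Gamma_complex_of_real)
    finally show ?thesis by (simp only: of_real_eq_iff)
  qed
  have sn: "summable (\<lambda>n. LBINT u. norm (f n u))"
  proof -
    have "summable (\<lambda>n. real n powr (- 2 * Re w))" using w by (subst summable_real_powr_iff) auto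
    then have "summable (\<lambda>n. real (Suc n) powr (- 2 * Re w))" by (subst summable_Suc_iff)
    then have "summable (\<lambda>n. pi powr (- Re w) * Gamma (Re w) * real (Suc n) powr (- 2 * Re w))"
      by (rule summable_mult)
    moreover have "a n powr (- Re w) = pi powr (- Re w) * real (Suc n) powr (- 2 * Re w)" for n
    proof -
      have "(real (Suc n))\<^sup>2 powr (- Re w) = (real (Suc n) powr 2) powr (- Re w)"
        by (simp only: powr_numeral of_nat_0_le_iff of_nat_0_less_iff zero_less_Suc)
      also have "\<dots> = real (Suc n) powr (- 2 * Re w)" by (simp only: powr_powr) simp
      finally have "(real (Suc n))\<^sup>2 powr (- Re w) = real (Suc n) powr (- 2 * Re w)" .
      then show ?thesis unfolding a_def by (subst powr_mult) (simp_all del: of_nat_Suc)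
    qed
    ultimately show ?thesis unfolding nfi by (simp only: mult_ac)
  qed
  have ss: "summable (\<lambda>n. exp (- a n * exp u))" for u
    using summable_jacobi_psi[of "exp u"] by (simp add: a_def)
  have "AE u in lborel. summable (\<lambda>n. norm (f n u))"
    using ss by (intro AE_I2) (auto simp: f_def norm_mult intro!: summable_mult2)
  note si = integrable_suminf[OF fi(1) this sn] sums_integral[OF fi(1) this sn]
  have sf: "(\<Sum>n. f n u) = g u" for u
  proof -
    have "(\<lambda>n. exp (- a n * exp u)) sums psi_exp u"
      using summable_sums[OF ss[of u]] by (simp add: psi_exp_def jacobi_psi_def a_def)
    then have "(\<lambda>n. f n u) sums g u"
      unfolding f_def g_def by (intro sums_mult2 sums_of_real)
    then show ?thesis by (simp add: sums_iff)
  qed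
  show "integrable lborel g" using si(1) unfolding sf .
  show "(\<lambda>n. of_real (pi * (real (Suc n))\<^sup>2) powr (- w) * Gamma w) sums (LBINT u. g u)"
    using si(2) unfolding sf fi(2) a_def .
qed

text \<open>Riemann's folding argument: on the reflected negative half-line
  \<open>psi_exp_reflect\<close> applies, where the factor exp (u/2) changes w into 1/2 - w and the
  remainder (exp (u/2) - 1) / 2 integrates to the polar terms.\<close>

lemma psi_exp_full_mellin_split:
  assumes w: "Re w > 1 / 2"
  shows "(LBINT u. of_real (psi_exp u) * exp (of_real u * w))
    = psi_mellin w + psi_mellin (1 / 2 - w) + (1 / (w - 1 / 2) - 1 / w) / 2"
proof -
  define g where "g u = complex_of_real (psi_exp u) * exp (of_real u * w)" for u
  define h where "h u = indicator {..<0} u *\<^sub>R g u" for u :: real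
  have gi: "integrable lborel g" unfolding g_def using psi_exp_full_mellin(1)[OF w] .
  have hi: "integrable lborel h" unfolding h_def using gi by (intro integrable_mult_indicator) auto
  have pi': "integrable lborel (\<lambda>u. indicator {0<..} u *\<^sub>R g u)"
    using gi by (intro integrable_mult_indicator) auto
  have "(LBINT u. g u) = (LBINT u. indicator {0<..} u *\<^sub>R g u + h u)"
  proof (rule integral_cong_AE)
    show "AE u in lborel. g u = indicator {0<..} u *\<^sub>R g u + h u"
      using AE_lborel_singleton[of 0] by eventually_elim (auto simp: h_def indicator_def)
  qed (use gi hi pi' in auto)
  also have "\<dots> = psi_mellin w + (LBINT u. h u)"
    using Bochner_Integration.integral_add[OF pi' hi] by (simp add: psi_mellin_def g_def)
  also have "(LBINT u. h u) = (LBINT u. h (- u))"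
    using lborel_integral_real_affine[of "-1" h 0] by simp
  also have "\<dots> = (LBINT u. indicator {0<..} u *\<^sub>R (of_real (psi_exp u) * exp (of_real u * (1 / 2 - w)))
     + (indicator {0<..} u *\<^sub>R exp (- (of_real u * (w - 1 / 2))) - indicator {0<..} u *\<^sub>R exp (- (of_real u * w))) / 2)"
  proof (rule Bochner_Integration.integral_cong[OF refl])
    fix u :: real
    have e: "complex_of_real (exp (u / 2)) * exp (- (of_real u * w)) = exp (of_real u * (1 / 2 - w))"
      by (simp add: exp_of_real[symmetric] exp_add[symmetric] algebra_simps)
    have e': "exp (- (complex_of_real u * (w - 1 / 2))) = exp (of_real u * (1 / 2 - w))"
      by (simp add: algebra_simps)
    have "g (- u) = (of_real (exp (u / 2)) * of_real (psi_exp u) + (of_real (exp (u / 2)) - 1) / 2) * exp (- (of_real u * w))"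
      by (simp add: g_def psi_exp_reflect)
    also have "\<dots> = of_real (psi_exp u) * (of_real (exp (u / 2)) * exp (- (of_real u * w)))
        + (of_real (exp (u / 2)) * exp (- (of_real u * w)) - exp (- (of_real u * w))) / 2"
      by (simp add: field_simps)
    finally show "h (- u) = indicator {0<..} u *\<^sub>R (of_real (psi_exp u) * exp (of_real u * (1 / 2 - w)))
     + (indicator {0<..} u *\<^sub>R exp (- (of_real u * (w - 1 / 2))) - indicator {0<..} u *\<^sub>R exp (- (of_real u * w))) / 2"
      unfolding e e' by (simp add: h_def indicator_def)
  qed
  also have "\<dots> = psi_mellin (1 / 2 - w) + (1 / (w - 1 / 2) - 1 / w) / 2"
    using psi_mellin_integrand(1)[of "1 / 2 - w"] exp_half_line_integral[of w] exp_half_line_integral[of "w - 1 / 2"] w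
    by (simp add: psi_mellin_def)
  finally show ?thesis by (simp add: g_def)
qed

section \<open>The xi function, its Dirichlet series and its growth\<close>

text \<open>Twice Riemann's classical xi. The completed zeta function is the sum of the two
  transforms and 1/(s - 1) - 1/s; multiplied by s (s - 1) the polar part becomes the constant 1. The
  formula is visibly entire and invariant under s -> 1 - s.\<close>

definition riemann_xi :: "complex \<Rightarrow> complex" where
  "riemann_xi s = 1 + s * (s - 1) * (psi_mellin (s / 2) + psi_mellin ((1 - s) / 2))"

lemma riemann_xi_0 [simp]: "riemann_xi 0 = 1" and riemann_xi_1 [simp]: "riemann_xi 1 = 1"
  by (simp_all add: riemann_xi_def)

lemma riemann_xi_reflect: "riemann_xi (1 - s) = riemann_xi s"
  by (simp add: riemann_xi_def algebra_simps)

lemma holomorphic_riemann_xi: "riemann_xi holomorphic_on A"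
proof -
  have *: "(\<lambda>s. psi_mellin (f s)) holomorphic_on UNIV" if "f holomorphic_on UNIV" for f
    using holomorphic_on_compose_gen[OF that holomorphic_psi_mellin] by (simp add: o_def)
  have "riemann_xi holomorphic_on UNIV"
    unfolding riemann_xi_def[abs_def] by (intro holomorphic_intros *) auto
  then show ?thesis by (rule holomorphic_on_subset) auto
qed

text \<open>Here w = s/2, so Re s > 1 is the region of termwise integration. Writing 1 / Gamma(s/2)
  as (s/2) \<open>rGamma (1 + s / 2)\<close> cancels the factor s, so the right-hand side keeps a
  denominator only at s = 1.\<close>

lemma riemann_xi_eq_Dirichlet_series:
  assumes s: "Re s > 1"
  shows "(\<lambda>n. 1 / of_nat (Suc n) powr s) sums
    (riemann_xi s * of_real pi powr (s / 2) * rGamma (1 + s / 2) / (2 * (s - 1)))"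
proof -
  define w where "w = s / 2"
  have w: "Re w > 1 / 2" using s by (simp add: w_def)
  have nz: "s \<noteq> 0" "s - 1 \<noteq> 0" using s by auto
  have Gnz: "Gamma w \<noteq> 0" using w by (auto simp: Gamma_eq_zero_iff elim!: nonpos_Ints_cases)
  have "s * (s - 1) * (LBINT u. of_real (psi_exp u) * exp (of_real u * w)) = riemann_xi s"
  proof -
    have "(1 / (w - 1 / 2) - 1 / w) / 2 = 1 / (s - 1) - 1 / s"
      using nz by (simp add: w_def divide_simps)
    moreover have "1 / 2 - w = (1 - s) / 2" by (simp add: w_def diff_divide_distrib)
    moreover have "s * (s - 1) * (X + (1 / (s - 1) - 1 / s)) = 1 + s * (s - 1) * X" for X
    proof -
      have "s * (s - 1) * (1 / (s - 1)) = s" "s * (s - 1) * (1 / s) = s - 1" using nz by auto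
      then show ?thesis by (simp only: distrib_left right_diff_distrib) simp
    qed
    ultimately show ?thesis
      by (simp only: psi_exp_full_mellin_split[OF w] riemann_xi_def) (simp only: w_def)
  qed
  moreover have "s * (s - 1) \<noteq> 0" using nz by simp
  ultimately have "(LBINT u. of_real (psi_exp u) * exp (of_real u * w)) = riemann_xi s / (s * (s - 1))"
    by (metis nonzero_mult_div_cancel_left)
  then have "(\<lambda>n. of_real (pi * (real (Suc n))\<^sup>2) powr (- w) * Gamma w) sums (riemann_xi s / (s * (s - 1)))"
    using psi_exp_full_mellin(2)[OF w] by (simp only:)
  moreover have "of_real (pi * (real (Suc n))\<^sup>2) powr (- w) = of_real pi powr (- w) * (1 / of_nat (Suc n) powr s)" for n
  proof -
    have "ln (pi * (real (Suc n))\<^sup>2) = ln pi + 2 * ln (real (Suc n))"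
      by (simp add: ln_mult ln_realpow del: of_nat_Suc)
    moreover have pw: "complex_of_real x powr z = exp (z * of_real (ln x))" if "x > 0" for x z
      using that by (simp add: powr_def Ln_of_real)
    ultimately have "of_real (pi * (real (Suc n))\<^sup>2) powr (- w) = exp (- w * of_real (ln pi + 2 * ln (real (Suc n))))"
      by (subst pw) (simp_all del: of_nat_Suc)
    also have "\<dots> = exp (- w * of_real (ln pi)) * exp (- (s * of_real (ln (real (Suc n)))))"
      by (simp add: exp_add[symmetric] w_def algebra_simps del: of_nat_Suc)
    also have "\<dots> = of_real pi powr (- w) * inverse (of_real (real (Suc n)) powr s)"
      by (subst (1 2) pw) (simp_all add: exp_minus del: of_nat_Suc)
    also have "\<dots> = of_real pi powr (- w) * (1 / of_nat (Suc n) powr s)"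
      by (simp add: divide_inverse del: of_nat_Suc)
    finally show ?thesis .
  qed
  ultimately have "(\<lambda>n. of_real pi powr (- w) * (1 / of_nat (Suc n) powr s) * Gamma w) sums (riemann_xi s / (s * (s - 1)))"
    by (simp only:)
  from sums_mult[OF this, of "of_real pi powr w / Gamma w"]
  have "(\<lambda>n. 1 / of_nat (Suc n) powr s) sums (of_real pi powr w / Gamma w * (riemann_xi s / (s * (s - 1))))"
    using Gnz by (simp add: powr_minus)
  moreover have "1 / Gamma w = w * rGamma (1 + w)"
    using rGamma_plus1[of w] by (simp add: rGamma_inverse_Gamma divide_inverse add.commute)
  then have "of_real pi powr w / Gamma w * (riemann_xi s / (s * (s - 1))) =
      of_real pi powr w * (w * rGamma (1 + w)) * (riemann_xi s / (s * (s - 1)))"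
    by (simp add: divide_inverse)
  moreover have "\<dots> = riemann_xi s * of_real pi powr (s / 2) * rGamma (1 + s / 2) / (2 * (s - 1))"
    using nz by (simp add: w_def field_simps)
  ultimately show ?thesis by simp
qed

text \<open>The arguments \<open>s / 2\<close> and \<open>(1 - s) / 2\<close> have norm at most r +
  1, and the bound for \<open>psi_mellin\<close> adds another 1. The logarithm absorbs the
  polynomial factor s (s - 1) and the two additions.\<close>

definition xi_growth :: "real \<Rightarrow> real" where
  "xi_growth r = 3 * ((r + 2) * sqrt (r + 2)) + ln (1 + 4 * r * (r + 1))"

lemma norm_riemann_xi_le: "norm (riemann_xi s) \<le> exp (xi_growth (norm s))"
proof -
  define r where "r = norm s"
  define E where "E = exp (3 * ((r + 2) * sqrt (r + 2)))"
  have r: "r \<ge> 0" by (simp add: r_def)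
  have b: "norm (psi_mellin w) \<le> 2 * E" if "norm w \<le> r + 1" for w
  proof -
    have "(norm w + 1) * sqrt (norm w + 1) \<le> (r + 2) * sqrt (r + 2)"
      using that r by (intro mult_mono) auto
    then show ?thesis using psi_mellin_integrand(2)[of w] unfolding E_def
      by (smt (verit) exp_le_cancel_iff)
  qed
  have 1: "norm (psi_mellin (s / 2)) \<le> 2 * E" by (rule b) (use r in \<open>simp add: r_def norm_divide\<close>)
  have "norm (1 - s) \<le> 1 + r" using norm_triangle_ineq4[of 1 s] by (simp add: r_def)
  then have 2: "norm (psi_mellin ((1 - s) / 2)) \<le> 2 * E"
    by (intro b) (use r in \<open>simp add: norm_divide\<close>)
  have "norm (riemann_xi s) \<le> 1 + norm (s * (s - 1) * (psi_mellin (s / 2) + psi_mellin ((1 - s) / 2)))"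
    unfolding riemann_xi_def using norm_triangle_ineq[of 1] by (metis norm_one)
  also have "\<dots> \<le> 1 + r * (r + 1) * (2 * E + 2 * E)"
    unfolding norm_mult r_def[symmetric] using norm_triangle_ineq4[of s 1] r
    by (intro add_left_mono mult_mono order_trans[OF norm_triangle_ineq] add_mono 1 2) (auto simp: r_def)
  also have "\<dots> \<le> E * (1 + 4 * r * (r + 1))"
  proof -
    have "E \<ge> 1" unfolding E_def using r by simp
    then show ?thesis by (simp add: algebra_simps)
  qed
  also have "\<dots> = exp (xi_growth r)"
  proof -
    have "1 + 4 * r * (r + 1) > 0" using r by (intro add_pos_nonneg) auto
    then show ?thesis by (simp add: E_def xi_growth_def exp_add)
  qed
  finally show ?thesis by (simp add: r_def)
qed

lemma xi_growth_limit: "((\<lambda>R. xi_growth (2 * R) / R\<^sup>2) \<longlongrightarrow> 0) at_top"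
  unfolding xi_growth_def by real_asymp

section \<open>Nontrivial zeros\<close>

text \<open>The entire continuation of (s - 1) zeta(s), including the point s = 1.\<close>

definition zeta_numerator :: "complex \<Rightarrow> complex" where
  "zeta_numerator s = riemann_xi s * of_real pi powr (s / 2) * rGamma (1 + s / 2) / 2"

lemma holomorphic_zeta_numerator: "zeta_numerator holomorphic_on A"
  unfolding zeta_numerator_def[abs_def] by (intro holomorphic_intros holomorphic_riemann_xi) auto

text \<open>Resolves the definite description: the Dirichlet series determines a candidate on Re s >
  1, and the punctured plane is connected, so the identity theorem gives uniqueness. The equation
  has no exception, since division by zero yields 0 at s = 1, which is the value prescribed
  there.\<close>

theorem riemann_zeta_eq: "riemann_zeta s = zeta_numerator s / (s - 1)"
proof -
  define P where "P f \<longleftrightarrow> f holomorphic_on (- {1}) \<and>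
     (\<forall>s. Re s > 1 \<longrightarrow> (\<lambda>n. 1 / of_nat (Suc n) powr s) sums f s) \<and> f 1 = 0" for f :: "complex \<Rightarrow> complex"
  define f where "f s = zeta_numerator s / (s - 1)" for s
  have f: "P f"
    unfolding P_def
  proof (intro conjI allI impI)
    show "f holomorphic_on (- {1})"
      unfolding f_def by (intro holomorphic_intros holomorphic_zeta_numerator) auto
    show "(\<lambda>n. 1 / of_nat (Suc n) powr s) sums f s" if "Re s > 1" for s
      using riemann_xi_eq_Dirichlet_series[OF that] by (simp add: f_def zeta_numerator_def)
  qed (simp add: f_def)
  have "g = f" if g: "P g" for g
  proof
    fix z
    show "g z = f z"
    proof (cases "z = 1")
      case False
      show ?thesis
      proof (rule analytic_continuation_open[of "{s. Re s > 1}" "- {1}" g f])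
        show "open {s. Re s > 1}" by (rule open_halfspace_Re_gt)
        show "{s. Re s > 1} \<noteq> {}" by (auto intro: exI[of _ 2])
        show "connected (- {1::complex})" by (rule connected_punctured_universe) simp
        show "g z = f z" if "z \<in> {s. Re s > 1}" for z
          using f g that unfolding P_def by (metis mem_Collect_eq sums_unique2)
      qed (use f g False in \<open>auto simp: P_def\<close>)
    qed (use f g in \<open>simp add: P_def\<close>)
  qed
  with f have "riemann_zeta = f"
    unfolding riemann_zeta_def P_def by (intro the_equality) blast+
  then have "riemann_zeta s = f s" by (rule fun_cong)
  then show ?thesis by (simp only: f_def)
qed

lemma holomorphic_riemann_zeta: "1 \<notin> A \<Longrightarrow> riemann_zeta holomorphic_on A"
  unfolding riemann_zeta_eq[abs_def] by (intro holomorphic_intros holomorphic_zeta_numerator) auto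

text \<open>The zeros of this factor are s = -2, -4, ..., the trivial zeros of zeta; the half-plane
  stops just short of them.\<close>

lemma rGamma_1_plus_half_nonzero: "Re s > -2 \<Longrightarrow> rGamma (1 + s / 2) \<noteq> 0"
proof
  assume s: "Re s > -2" and "rGamma (1 + s / 2) = 0"
  then obtain n where "1 + s / 2 = - of_nat n"
    by (auto simp: rGamma_eq_zero_iff elim!: nonpos_Ints_cases')
  then have "Re (1 + s / 2) = - real n" by simp
  then show False using s by simp
qed

lemma riemann_xi_eq_0_iff:
  assumes "Re s > -2" "s \<noteq> 1"
  shows "riemann_xi s = 0 \<longleftrightarrow> riemann_zeta s = 0"
  using assms rGamma_1_plus_half_nonzero[of s] by (simp add: riemann_zeta_eq zeta_numerator_def)

section \<open>Euler product and absence of zeros for Re s >= 1\<close>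

lemma norm_of_nat_powr: "norm (of_nat n powr s :: complex) = real n powr Re s"
  by (simp add: norm_powr_real_powr)

lemma riemann_zeta_sums:
  assumes "Re s > 1"
  shows "(\<lambda>n. of_nat n powr (- s)) sums riemann_zeta s"
proof -
  have "(\<lambda>n. of_nat (Suc n) powr (- s)) sums riemann_zeta s"
  proof -
    have "riemann_xi s * of_real pi powr (s / 2) * rGamma (1 + s / 2) / (2 * (s - 1)) = riemann_zeta s"
      by (simp add: riemann_zeta_eq zeta_numerator_def)
    then show ?thesis
      using riemann_xi_eq_Dirichlet_series[OF assms] by (simp only: powr_minus divide_inverse mult_1_left)
  qed
  \<comment> \<open>The index may start at 0 because 0 \<open>powr\<close> anything is 0.\<close>
  then have "(\<lambda>n. of_nat n powr (- s)) sums (riemann_zeta s + of_nat 0 powr (- s))"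
    by (subst sums_Suc_iff[symmetric]) simp
  then show ?thesis by simp
qed

lemma summable_nat_powr_minus: "\<sigma> > 1 \<Longrightarrow> summable (\<lambda>n. real n powr (- \<sigma>))"
  by (subst summable_real_powr_iff) auto

definition euler_factors :: "nat set \<Rightarrow> complex \<Rightarrow> complex" where
  "euler_factors P s = (\<Prod>p\<in>P. 1 - of_nat p powr (- s))"

text \<open>Sieve of Eratosthenes: each Euler factor removes the multiples of its prime.\<close>

lemma zeta_sieve:
  assumes s: "Re s > 1" and "finite P" "\<And>p. p \<in> P \<Longrightarrow> prime p"
  shows "((\<lambda>n. of_nat n powr (- s)) has_sum (riemann_zeta s * euler_factors P s)) {n. \<forall>p\<in>P. \<not> p dvd n}"
  using assms(2,3)
proof (induction P)
  case empty
  have "summable (\<lambda>n. norm (of_nat n powr (- s) :: complex))"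
    unfolding norm_of_nat_powr using summable_nat_powr_minus[OF s] by simp
  then show ?case
    using norm_summable_imp_has_sum[OF _ riemann_zeta_sums[OF s]] by (simp add: euler_factors_def)
next
  case (insert q P)
  define f where "f n = complex_of_nat n powr (- s)" for n
  define A where "A = {n. \<forall>p\<in>P. \<not> p dvd n}"
  define Z where "Z = riemann_zeta s * euler_factors P s"
  have q: "prime q" and P: "\<And>p. p \<in> P \<Longrightarrow> prime p" using insert.prems by auto
  have IH: "(f has_sum Z) A" unfolding f_def[abs_def] A_def Z_def by (rule insert.IH[OF P])
  have "f (q * n) = f q * f n" for n
    unfolding f_def of_nat_mult by (rule powr_times_real) auto
  then have "((f \<circ> (*) q) has_sum (f q * Z)) A"
    using has_sum_cmult_right[OF IH, of "f q"] by (simp add: o_def)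
  moreover have "inj_on ((*) q) A" using q by (auto simp: inj_on_def prime_gt_0_nat)
  ultimately have "(f has_sum (f q * Z)) ((*) q ` A)" by (simp add: has_sum_reindex)
  moreover have sub: "(*) q ` A \<subseteq> A"
  proof
    fix n assume "n \<in> (*) q ` A"
    then obtain m where m: "n = q * m" "m \<in> A" by auto
    have "\<not> p dvd n" if "p \<in> P" for p
    proof
      assume "p dvd n"
      then have "p dvd q \<or> p dvd m" using P[OF that] m by (simp add: prime_dvd_mult_iff)
      moreover have "\<not> p dvd q" using P[OF that] q that insert.hyps primes_dvd_imp_eq by blast
      ultimately show False using m that by (auto simp: A_def)
    qed
    then show "n \<in> A" by (simp add: A_def)
  qed
  ultimately have "(f has_sum (Z - f q * Z)) (A - (*) q ` A)"
    using has_sum_Diff[OF IH] by blast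
  moreover have "A - (*) q ` A = {n. \<forall>p\<in>insert q P. \<not> p dvd n}"
  proof -
    have "n \<in> (*) q ` A" if qn: "q dvd n" and nA: "n \<in> A" for n
    proof -
      obtain k where k: "n = q * k" using qn by (rule dvdE)
      then have "k \<in> A" using nA by (auto simp: A_def)
      then show ?thesis using k by blast
    qed
    then show ?thesis by (auto simp: A_def)
  qed
  moreover have "Z - f q * Z = riemann_zeta s * euler_factors (insert q P) s"
    using insert.hyps by (simp add: Z_def f_def euler_factors_def algebra_simps)
  ultimately show ?case by (simp only: f_def[abs_def])
qed

text \<open>After sieving by the primes up to N, each fixed n > 1 has disappeared once N >= n, and 1
  survives; Tannery's theorem with majorant n^(-Re s) passes to the limit. Keeping zeta multiplied
  by the finite product avoids infinite products and division, and shows at once that zeta(s) is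
  nonzero.\<close>

lemma zeta_euler_product:
  assumes s: "Re s > 1"
  shows "(\<lambda>N. riemann_zeta s * euler_factors {p. prime p \<and> p \<le> N} s) \<longlonglongrightarrow> 1"
proof -
  define A where "A N = {n. \<forall>p\<in>{p. prime p \<and> p \<le> N}. \<not> p dvd n}" for N :: nat
  define a where "a n N = (if n \<in> A N then complex_of_nat n powr (- s) else 0)" for n N
  define b where "b n = (if n = 1 then 1 else 0 :: complex)" for n :: nat
  have fin: "finite {p::nat. prime p \<and> p \<le> N}" for N by (rule finite_subset[of _ "{..N}"]) auto
  have suma: "(\<Sum>n. a n N) = riemann_zeta s * euler_factors {p. prime p \<and> p \<le> N} s" for N
  proof -
    have "((\<lambda>n. a n N) has_sum (riemann_zeta s * euler_factors {p. prime p \<and> p \<le> N} s)) UNIV"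
    proof (rule has_sum_cong_neutral[THEN iffD1])
      show "((\<lambda>n. of_nat n powr (- s)) has_sum (riemann_zeta s * euler_factors {p. prime p \<and> p \<le> N} s)) (A N)"
        unfolding A_def by (rule zeta_sieve[OF s fin]) auto
    qed (auto simp: a_def)
    then show ?thesis by (rule sums_unique[OF has_sum_imp_sums, symmetric])
  qed
  have lim: "(\<lambda>N. a n N) \<longlonglongrightarrow> b n" for n
  proof -
    have "eventually (\<lambda>N. a n N = b n) sequentially"
      using eventually_ge_at_top[of n]
    proof eventually_elim
      case (elim N)
      consider "n = 0" | "n = 1" | "n > 1" by linarith
      then show ?case
      proof cases
        case 2
        then have "n \<in> A N" by (auto simp: A_def)
        then show ?thesis using 2 by (simp add: a_def b_def)
      next
        case 3
        then obtain p where p: "prime p" "p dvd n" using prime_factor_nat[of n] by auto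
        then have "p \<le> N" using 3 elim dvd_imp_le[of p n] by linarith
        then have "n \<notin> A N" using p by (auto simp: A_def)
        then show ?thesis using 3 by (simp add: a_def b_def)
      qed (simp add: a_def b_def)
    qed
    then show ?thesis by (rule tendsto_eventually)
  qed
  have "(\<lambda>N. \<Sum>n. a n N) \<longlonglongrightarrow> suminf b"
  proof (rule tannerys_theorem[THEN conjunct2, THEN conjunct2])
    show "\<And>n. (\<lambda>N. a n N) \<longlonglongrightarrow> b n" by (rule lim)
    show "eventually (\<lambda>(n, N). norm (a n N) \<le> real n powr (- Re s)) (at_top \<times>\<^sub>F sequentially)"
      by (intro always_eventually) (auto simp: a_def norm_of_nat_powr)
    show "summable (\<lambda>n. real n powr (- Re s))" by (rule summable_nat_powr_minus[OF s])
  qed simp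
  moreover have "suminf b = 1"
    unfolding b_def by (subst suminf_finite[where N = "{1}"]) auto
  ultimately show ?thesis unfolding suma by simp
qed

lemma riemann_zeta_nonzero_right: "Re s > 1 \<Longrightarrow> riemann_zeta s \<noteq> 0"
proof
  assume s: "Re s > 1" and z: "riemann_zeta s = 0"
  have "(\<lambda>N::nat. 0 :: complex) \<longlonglongrightarrow> 1" using zeta_euler_product[OF s] by (simp add: z)
  then show False using LIMSEQ_unique tendsto_const zero_neq_one by blast
qed

text \<open>Uses \<open>3 + 4 cos \<theta> + cos 2\<theta> = 2 (1 + cos \<theta>)\<^sup>2 \<ge> 0\<close> in each term of the logarithmic series.\<close>

lemma three_four_one:
  fixes r :: real and u :: complex
  assumes r: "0 \<le> r" "r < 1" and u: "norm u = 1"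
  shows "norm (1 - of_real r :: complex) ^ 3 * norm (1 - of_real r * u) ^ 4 * norm (1 - of_real r * u\<^sup>2) \<le> 1"
proof -
  have L: "(\<lambda>n. - ((of_real r * v) ^ n) / of_nat n) sums ln (1 - of_real r * v)"
    and nz: "1 - of_real r * v \<noteq> 0" if "norm v = 1" for v :: complex
  proof -
    have n: "norm (- (of_real r * v)) < 1" using that r by (simp add: norm_mult)
    show "(\<lambda>n. - ((of_real r * v) ^ n) / of_nat n) sums ln (1 - of_real r * v)"
      using Ln_series'[OF n] by simp
    show "1 - of_real r * v \<noteq> 0" using n by auto
  qed
  have u2: "norm (u\<^sup>2) = 1" using u by (simp add: norm_power)
  define l where "l v = Re (ln (1 - of_real r * v))" for v
  have nl: "norm (1 - of_real r * v) = exp (l v)" if "norm v = 1" for v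
    using norm_exp_eq_Re[of "ln (1 - of_real r * v)"] nz[OF that] by (simp add: l_def)
  have "(\<lambda>n. 3 * Re (- ((of_real r * 1) ^ n) / of_nat n) + 4 * Re (- ((of_real r * u) ^ n) / of_nat n)
      + Re (- ((of_real r * u\<^sup>2) ^ n) / of_nat n)) sums (3 * l 1 + 4 * l u + l (u\<^sup>2))"
    unfolding l_def using L[of 1] L[OF u] L[OF u2] by (intro sums_add sums_mult sums_Re) auto
  then have "3 * l 1 + 4 * l u + l (u\<^sup>2) \<le> 0"
  proof (rule sums_le[OF _ _ sums_zero, rotated])
    fix n
    define c where "c = Re (u ^ n)"
    have "norm (u ^ n) = 1" using u by (simp add: norm_power)
    then have "(Re (u ^ n))\<^sup>2 + (Im (u ^ n))\<^sup>2 = 1" by (simp add: cmod_power2[symmetric])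
    then have "Re ((u ^ n)\<^sup>2) = 2 * c\<^sup>2 - 1" by (simp add: c_def Re_power2)
    then have c2: "Re ((u\<^sup>2) ^ n) = 2 * c\<^sup>2 - 1" by (simp add: power_mult[symmetric] mult.commute)
    have "Re (- ((of_real r * v) ^ n) / of_nat n) = - (r ^ n / n * Re (v ^ n))" for v
      by (simp add: power_mult_distrib of_real_power[symmetric] Re_divide_of_nat del: of_real_power)
    then have "3 * Re (- ((of_real r * 1) ^ n) / of_nat n) + 4 * Re (- ((of_real r * u) ^ n) / of_nat n)
      + Re (- ((of_real r * u\<^sup>2) ^ n) / of_nat n) = - (r ^ n / n * (3 + 4 * c + (2 * c\<^sup>2 - 1)))"
      by (simp only: c2 c_def[symmetric]) (simp add: algebra_simps add_divide_distrib)
    also have "3 + 4 * c + (2 * c\<^sup>2 - 1) = 2 * (1 + c)\<^sup>2" by (simp add: power2_eq_square algebra_simps)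
    also have "- (r ^ n / n * (2 * (1 + c)\<^sup>2)) \<le> 0" using r by simp
    finally show "3 * Re (- ((of_real r * 1) ^ n) / of_nat n) + 4 * Re (- ((of_real r * u) ^ n) / of_nat n)
      + Re (- ((of_real r * u\<^sup>2) ^ n) / of_nat n) \<le> 0" .
  qed
  moreover have "norm (1 - of_real r :: complex) ^ 3 * norm (1 - of_real r * u) ^ 4 * norm (1 - of_real r * u\<^sup>2)
      = exp (3 * l 1 + 4 * l u + l (u\<^sup>2))"
    using nl[of 1] nl[OF u] nl[OF u2] by (simp add: exp_add exp_of_nat_mult[symmetric])
  ultimately show ?thesis by simp
qed

text \<open>\<open>three_four_one\<close> is applied prime by prime with r = p^(-sigma) and u =
  p^(-it). The Euler factors are the reciprocals of those of zeta, so an upper bound 1 for their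
  products becomes a lower bound 1 for zeta in the limit.\<close>

lemma riemann_zeta_three_four_one:
  assumes \<sigma>: "\<sigma> > 1"
  shows "norm (riemann_zeta (of_real \<sigma>)) ^ 3 * norm (riemann_zeta (of_real \<sigma> + \<i> * of_real t)) ^ 4
    * norm (riemann_zeta (of_real \<sigma> + \<i> * of_real (2 * t))) \<ge> 1"
proof -
  define s1 s2 s3 where "s1 = complex_of_real \<sigma>" and "s2 = of_real \<sigma> + \<i> * of_real t"
    and "s3 = of_real \<sigma> + \<i> * of_real (2 * t)"
  have s: "Re s1 > 1" "Re s2 > 1" "Re s3 > 1" using \<sigma> by (auto simp: s1_def s2_def s3_def)
  define E where "E N s = euler_factors {p. prime p \<and> p \<le> N} s" for N s
  have Ele: "norm (E N s1) ^ 3 * norm (E N s2) ^ 4 * norm (E N s3) \<le> 1" for N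
  proof -
    have "norm (E N s1) ^ 3 * norm (E N s2) ^ 4 * norm (E N s3) =
      (\<Prod>p\<in>{p. prime p \<and> p \<le> N}. norm (1 - of_nat p powr (- s1) :: complex) ^ 3 *
         norm (1 - of_nat p powr (- s2) :: complex) ^ 4 * norm (1 - of_nat p powr (- s3) :: complex))"
      by (simp add: E_def euler_factors_def prod_norm[symmetric] prod.distrib prod_power_distrib)
    also have "\<dots> \<le> 1"
    proof (rule prod_le_1, intro conjI)
      fix p assume "p \<in> {p. prime p \<and> p \<le> N}"
      then have p: "p > 1" using prime_gt_1_nat by auto
      define r where "r = real p powr (- \<sigma>)"
      define u where "u = exp (- (\<i> * of_real (t * ln p)))"
      have ex: "of_nat p powr z = exp (z * of_real (ln (real p)))" for z :: complex
        using p Ln_of_nat[of p] by (simp add: powr_def)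
      have r: "of_nat p powr (- s1) = complex_of_real r"
        using p by (simp add: ex s1_def r_def powr_def exp_of_real[symmetric])
      have "of_nat p powr (- s2) = complex_of_real r * u"
        using p by (simp add: ex s2_def r_def powr_def exp_of_real[symmetric] u_def exp_add[symmetric] algebra_simps)
      moreover have "of_nat p powr (- s3) = complex_of_real r * u\<^sup>2"
        using p by (simp add: ex s3_def r_def powr_def exp_of_real[symmetric] u_def exp_add[symmetric] power2_eq_square algebra_simps)
      moreover have "0 \<le> r" by (simp add: r_def)
      moreover have "r < 1" using p \<sigma> by (simp add: r_def powr_less_one)
      moreover have "norm u = 1" by (simp add: u_def norm_exp_eq_Re)
      ultimately show "norm (1 - of_nat p powr (- s1) :: complex) ^ 3 *
         norm (1 - of_nat p powr (- s2) :: complex) ^ 4 * norm (1 - of_nat p powr (- s3) :: complex) \<le> 1"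
        using three_four_one[of r u] by (simp add: r)
    qed auto
    finally show ?thesis .
  qed
  define X where "X = norm (riemann_zeta s1) ^ 3 * norm (riemann_zeta s2) ^ 4 * norm (riemann_zeta s3)"
  have "(\<lambda>N. norm (riemann_zeta s1 * E N s1) ^ 3 * norm (riemann_zeta s2 * E N s2) ^ 4 * norm (riemann_zeta s3 * E N s3))
     \<longlonglongrightarrow> norm (1::complex) ^ 3 * norm (1::complex) ^ 4 * norm (1::complex)"
    unfolding E_def by (intro tendsto_intros zeta_euler_product s)
  moreover have "norm (riemann_zeta s1 * E N s1) ^ 3 * norm (riemann_zeta s2 * E N s2) ^ 4 * norm (riemann_zeta s3 * E N s3) \<le> X" for N
  proof -
    have "norm (riemann_zeta s1 * E N s1) ^ 3 * norm (riemann_zeta s2 * E N s2) ^ 4 * norm (riemann_zeta s3 * E N s3)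
      = X * (norm (E N s1) ^ 3 * norm (E N s2) ^ 4 * norm (E N s3))"
      by (simp add: X_def norm_mult power_mult_distrib mult_ac)
    also have "\<dots> \<le> X * 1" using Ele by (intro mult_left_mono) (auto simp: X_def)
    finally show ?thesis by simp
  qed
  ultimately have "norm (1::complex) ^ 3 * norm (1::complex) ^ 4 * norm (1::complex) \<le> X"
    using LIMSEQ_le_const2 by blast
  then show ?thesis by (simp add: X_def s1_def s2_def s3_def)
qed

text \<open>Mertens' argument along 1 + h with h -> 0: a zero at 1 + it supplies four factors h, the
  pole at 1 only three factors 1/h, and zeta stays bounded near 1 + 2it. The product would tend to 0
  while being at least 1. \<open>zeta_numerator\<close> takes the place of zeta at the pole, the
  difference quotient takes its place at the zero.\<close>

lemma riemann_zeta_nonzero_line: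
  assumes t: "t \<noteq> 0"
  shows "riemann_zeta (1 + \<i> * of_real t) \<noteq> 0"
proof
  define z where "z = 1 + \<i> * of_real t"
  assume "riemann_zeta (1 + \<i> * of_real t) = 0"
  then have z0: "riemann_zeta z = 0" by (simp add: z_def)
  define h where "h n = 1 / real (Suc n)" for n
  have h: "h n > 0" for n by (simp add: h_def)
  have h0: "h \<longlonglongrightarrow> 0" unfolding h_def by real_asymp
  have hc: "(\<lambda>n. complex_of_real (h n)) \<longlonglongrightarrow> 0" using tendsto_of_real[OF h0] by simp
  have hat: "filterlim (\<lambda>n. complex_of_real (h n)) (at 0) sequentially"
    using hc h by (intro filterlim_atI) (auto intro!: always_eventually simp: less_imp_neq[OF h, symmetric])
  have cont: "isCont riemann_zeta w" if "w \<noteq> 1" for w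
  proof -
    have "riemann_zeta holomorphic_on (- {1})" by (rule holomorphic_riemann_zeta) simp
    then have "riemann_zeta field_differentiable (at w)"
      using that by (intro holomorphic_on_imp_differentiable_at[of _ "- {1}"]) auto
    then show ?thesis by (rule field_differentiable_imp_continuous_at)
  qed
  have "riemann_zeta field_differentiable (at z)"
    using holomorphic_riemann_zeta[of "- {1}"] t by (intro holomorphic_on_imp_differentiable_at[of _ "- {1}"]) (auto simp: z_def)
  then obtain D where "(riemann_zeta has_field_derivative D) (at z)"
    unfolding field_differentiable_def by blast
  then have "((\<lambda>x. (riemann_zeta (z + x) - riemann_zeta z) / x) \<longlongrightarrow> D) (at 0)"
    unfolding DERIV_def .
  from filterlim_compose[OF this hat]
  have l2: "(\<lambda>n. riemann_zeta (z + of_real (h n)) / of_real (h n)) \<longlonglongrightarrow> D" by (simp add: z0)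
  have nc: "isCont zeta_numerator 1"
    using holomorphic_on_imp_continuous_on[OF holomorphic_zeta_numerator[of UNIV]]
    by (simp add: continuous_on_eq_continuous_at)
  have l1: "(\<lambda>n. zeta_numerator (1 + of_real (h n))) \<longlonglongrightarrow> zeta_numerator 1"
    by (rule isCont_tendsto_compose[OF nc]) (use tendsto_add[OF tendsto_const hc, of 1] in simp)
  define w where "w = 1 + \<i> * of_real (2 * t)"
  have w: "w \<noteq> 1" using t by (simp add: w_def)
  have l3: "(\<lambda>n. riemann_zeta (w + of_real (h n))) \<longlonglongrightarrow> riemann_zeta w"
    by (rule isCont_tendsto_compose[OF cont[OF w]]) (use tendsto_add[OF tendsto_const hc, of w] in simp)
  have "(\<lambda>n. norm (zeta_numerator (1 + of_real (h n))) ^ 3 * norm (riemann_zeta (z + of_real (h n)) / of_real (h n)) ^ 4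
     * norm (riemann_zeta (w + of_real (h n))) * h n) \<longlonglongrightarrow>
     norm (zeta_numerator 1) ^ 3 * norm D ^ 4 * norm (riemann_zeta w) * 0"
    by (intro tendsto_intros l1 l2 l3 h0)
  moreover have "norm (zeta_numerator (1 + of_real (h n))) ^ 3 * norm (riemann_zeta (z + of_real (h n)) / of_real (h n)) ^ 4
     * norm (riemann_zeta (w + of_real (h n))) * h n \<ge> 1" for n
  proof -
    have e: "complex_of_real (1 + h n) = 1 + of_real (h n)"
      "complex_of_real (1 + h n) + \<i> * of_real t = z + of_real (h n)"
      "complex_of_real (1 + h n) + \<i> * of_real (2 * t) = w + of_real (h n)"
      by (simp_all add: z_def w_def)
    have "1 \<le> norm (riemann_zeta (1 + of_real (h n))) ^ 3 * norm (riemann_zeta (z + of_real (h n))) ^ 4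
      * norm (riemann_zeta (w + of_real (h n)))"
      using riemann_zeta_three_four_one[of "1 + h n" t, unfolded e(2,3), unfolded e(1)] h[of n] by simp
    also have "riemann_zeta (1 + of_real (h n)) = zeta_numerator (1 + of_real (h n)) / of_real (h n)"
      by (simp add: riemann_zeta_eq)
    also have "norm (zeta_numerator (1 + of_real (h n)) / of_real (h n)) ^ 3 * norm (riemann_zeta (z + of_real (h n))) ^ 4
      * norm (riemann_zeta (w + of_real (h n))) = norm (zeta_numerator (1 + of_real (h n))) ^ 3 * norm (riemann_zeta (z + of_real (h n)) / of_real (h n)) ^ 4
     * norm (riemann_zeta (w + of_real (h n))) * h n"
      using h[of n] by (simp add: norm_divide power_divide) (simp add: field_simps eval_nat_numeral)?
    finally show ?thesis .
  qed
  ultimately have "1 \<le> norm (zeta_numerator 1) ^ 3 * norm D ^ 4 * norm (riemann_zeta w) * (0::real)"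
    using LIMSEQ_le_const by blast
  then show False by simp
qed

lemma riemann_xi_nonzero_right:
  assumes "Re s \<ge> 1"
  shows "riemann_xi s \<noteq> 0"
proof (cases "s = 1")
  case False
  have "riemann_zeta s \<noteq> 0"
  proof (cases "Re s = 1")
    case True
    then have "s = 1 + \<i> * of_real (Im s)" by (simp add: complex_eq_iff)
    moreover have "Im s \<noteq> 0" using False True by (simp add: complex_eq_iff)
    ultimately show ?thesis using riemann_zeta_nonzero_line by metis
  qed (use assms riemann_zeta_nonzero_right in auto)
  then show ?thesis using riemann_xi_eq_0_iff[of s] False assms by auto
qed simp

section \<open>The zeros of xi and their multiplicities\<close>

text \<open>Reflection carries the zero-free half-plane Re s >= 1 to Re s <= 0, so xi has zeros only
  in the open strip, and there it differs from zeta by non-vanishing factors.\<close>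

theorem riemann_xi_zeros: "{\<rho>. riemann_xi \<rho> = 0} = nontrivial_zeros"
proof -
  have "0 < Re \<rho> \<and> Re \<rho> < 1" if "riemann_xi \<rho> = 0" for \<rho>
    using riemann_xi_nonzero_right[of \<rho>] riemann_xi_nonzero_right[of "1 - \<rho>"] that
    by (auto simp: riemann_xi_reflect not_le[symmetric])
  moreover have "riemann_xi \<rho> = 0 \<longleftrightarrow> riemann_zeta \<rho> = 0" if "0 < Re \<rho>" "Re \<rho> < 1" for \<rho>
    using that by (intro riemann_xi_eq_0_iff) auto
  ultimately show ?thesis unfolding nontrivial_zeros_def by blast
qed

lemma zorder_riemann_xi:
  assumes "\<rho> \<in> nontrivial_zeros"
  shows "zorder riemann_xi \<rho> = zorder riemann_zeta \<rho>"
proof -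
  define c where "c s = of_real pi powr (s / 2) * rGamma (1 + s / 2) / (2 * (s - 1))" for s :: complex
  have \<rho>: "0 < Re \<rho>" "Re \<rho> < 1" "\<rho> \<noteq> 1" using assms by (auto simp: nontrivial_zeros_def)
  have an: "f analytic_on {\<rho>}" if "f holomorphic_on - {1}" for f
    using that \<rho>(3) by (subst analytic_at) (auto intro!: exI[of _ "- {1}"])
  have ch: "c holomorphic_on - {1}" unfolding c_def by (intro holomorphic_intros) auto
  have zc: "zorder c \<rho> = 0"
    by (rule zorder_eq_0I[OF an[OF ch]]) (use \<rho> rGamma_1_plus_half_nonzero[of \<rho>] in \<open>auto simp: c_def\<close>)
  have eq: "riemann_zeta = (\<lambda>s. riemann_xi s * c s)"
    by (simp add: fun_eq_iff riemann_zeta_eq zeta_numerator_def c_def)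
  \<comment> \<open>The additivity of orders needs a product that is nonzero near the point; zeta(2)
    being nonzero, zeros in the connected punctured plane are isolated.\<close>
  have "eventually (\<lambda>z. riemann_zeta z \<noteq> 0) (at \<rho>)"
    by (rule non_zero_neighbour_alt[of riemann_zeta "- {1}" \<rho> 2, THEN eventually_mono])
       (use \<rho> riemann_zeta_nonzero_right[of 2] in \<open>auto intro!: holomorphic_riemann_zeta connected_punctured_universe\<close>)
  then have "zorder (\<lambda>s. riemann_xi s * c s) \<rho> = zorder riemann_xi \<rho> + zorder c \<rho>"
    unfolding eq by (intro zorder_times_analytic an ch holomorphic_riemann_xi)
  then show ?thesis using zc by (simp add: eq)
qed

section \<open>The logarithmic derivative of Hardy's function\<close>

text \<open>In the trigamma series put x = k + y; then |z + k|^2 >= k^2 + y^2 >= x^2 / 2. The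
  telescoping majorant 6 (1/x - 1/(x + 1)) exceeds 2 / x^2 precisely when x + 1 <= 3x, that is x >=
  1/2, which explains both the 6 and the condition on \<open>y\<close>.\<close>

lemma Polygamma_1_le:
  fixes a y :: real
  assumes a: "a \<ge> 0" and y: "y \<ge> 1 / 2"
  shows "norm (Polygamma 1 (of_real a + \<i> * of_real y)) \<le> 6 / y"
proof -
  define z where "z = of_real a + \<i> * of_real y"
  have z: "z \<noteq> 0" using y by (auto simp: z_def complex_eq_iff)
  have tel: "(\<lambda>k. 6 * (1 / (real k + y) - 1 / (real (Suc k) + y))) sums (6 * (1 / (real 0 + y) - 0))"
  proof (intro sums_mult telescope_sums')
    show "(\<lambda>k. 1 / (real k + y)) \<longlonglongrightarrow> 0" by real_asymp
  qed
  have le: "norm (inverse ((z + of_nat k) ^ 2)) \<le> 6 * (1 / (real k + y) - 1 / (real (Suc k) + y))" for k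
  proof -
    define x where "x = real k + y"
    have x: "x \<ge> 1 / 2" using y by (simp add: x_def)
    have "x\<^sup>2 \<le> 2 * ((real k)\<^sup>2 + y\<^sup>2)"
      using zero_le_power2[of "real k - y"] by (simp add: x_def power2_eq_square algebra_simps)
    also have "\<dots> \<le> 2 * ((a + real k)\<^sup>2 + y\<^sup>2)" using a by (intro mult_left_mono add_right_mono power_mono) auto
    also have "(a + real k)\<^sup>2 + y\<^sup>2 = (norm (z + of_nat k))\<^sup>2" by (simp add: z_def cmod_power2)
    finally have "x\<^sup>2 / 2 \<le> (norm (z + of_nat k))\<^sup>2" by simp
    then have "inverse ((norm (z + of_nat k))\<^sup>2) \<le> inverse (x\<^sup>2 / 2)"
      using x by (intro le_imp_inverse_le) auto
    also have "\<dots> \<le> 6 * (1 / x - 1 / (x + 1))"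
      using x by (simp add: divide_simps power2_eq_square)
    finally show ?thesis by (simp add: norm_inverse norm_power x_def add_ac)
  qed
  have "norm (\<Sum>k. inverse ((z + of_nat k) ^ 2)) \<le> (\<Sum>k. 6 * (1 / (real k + y) - 1 / (real (Suc k) + y)))"
    by (rule norm_suminf_le[OF le sums_summable[OF tel]])
  also have "\<dots> = 6 / y" using sums_unique[OF tel] by simp
  finally show ?thesis unfolding z_def[symmetric] by (simp add: Polygamma_def numeral_2_eq_2)
qed

text \<open>Logarithmic derivatives of the four factors of zeta, in the order xi, power of pi,
  \<open>rGamma\<close>, 1/(s - 1). The explicit form is what gets differentiated again.\<close>

definition zeta_logderiv :: "complex \<Rightarrow> complex" where
  "zeta_logderiv z = deriv riemann_xi z / riemann_xi z + of_real (ln pi) / 2 - Digamma (1 + z / 2) / 2 - 1 / (z - 1)"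

lemma not_nonpos_Ints_if_Re_pos: "Re z > 0 \<Longrightarrow> z \<notin> \<int>\<^sub>\<le>\<^sub>0"
  by (auto elim!: nonpos_Ints_cases')

lemma has_field_derivative_riemann_xi:
  "(riemann_xi has_field_derivative deriv riemann_xi z) (at z)"
  using holomorphic_derivI[OF holomorphic_riemann_xi open_UNIV] by blast

lemma has_field_derivative_riemann_zeta:
  assumes "Re z > -2" "riemann_zeta z \<noteq> 0" "z \<noteq> 1"
  shows "(riemann_zeta has_field_derivative riemann_zeta z * zeta_logderiv z) (at z)"
proof -
  have xi: "riemann_xi z \<noteq> 0" using assms riemann_xi_eq_0_iff by blast
  have G: "1 + z / 2 \<notin> \<int>\<^sub>\<le>\<^sub>0" using assms by (intro not_nonpos_Ints_if_Re_pos) simp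
  have d1: "((\<lambda>z. of_real pi powr (z / 2)) has_field_derivative of_real pi powr (z / 2) * (of_real (ln pi) / 2)) (at z)"
    unfolding powr_def by (auto intro!: derivative_eq_intros simp: Ln_of_real)
  have d2: "((\<lambda>z. rGamma (1 + z / 2)) has_field_derivative - rGamma (1 + z / 2) * Digamma (1 + z / 2) * (1 / 2)) (at z)"
    by (rule DERIV_chain2[where g = "\<lambda>z. 1 + z / 2", OF has_field_derivative_rGamma_no_nonpos_int[OF G]]) (auto intro!: derivative_eq_intros)
  have d3: "((\<lambda>z. 1 / (2 * (z - 1))) has_field_derivative 1 / (2 * (z - 1)) * (- 1 / (z - 1))) (at z)"
  proof -
    define w where "w = z - 1"
    have w: "w \<noteq> 0" using assms(3) by (simp add: w_def)
    have "((\<lambda>z. 1 / (2 * (z - 1))) has_field_derivative (0 * (2 * w) - 1 * 2) / ((2 * w) * (2 * w))) (at z)"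
      unfolding w_def by (rule DERIV_divide) (use w in \<open>auto intro!: derivative_eq_intros simp: w_def\<close>)
    moreover have "(0 * (2 * w) - 1 * 2) / ((2 * w) * (2 * w)) = 1 / (2 * w) * (- 1 / w)"
      using w by (simp add: divide_simps)
    ultimately show ?thesis by (simp only: w_def)
  qed
  define F where "F z = riemann_xi z * (of_real pi powr (z / 2) * (rGamma (1 + z / 2) * (1 / (2 * (z - 1)))))" for z
  have "(F has_field_derivative F z * zeta_logderiv z) (at z)"
    unfolding F_def
    by (rule DERIV_cong[OF DERIV_mult[OF has_field_derivative_riemann_xi DERIV_mult[OF d1 DERIV_mult[OF d2 d3]]]])
       (use xi assms(3) in \<open>simp add: zeta_logderiv_def divide_simps, simp add: algebra_simps\<close>)
  moreover have "riemann_zeta = F"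
    by (simp add: fun_eq_iff riemann_zeta_eq zeta_numerator_def F_def)
  ultimately show ?thesis by simp
qed

lemma has_field_derivative_zeta_logderiv:
  assumes "Re z > -2" "riemann_zeta z \<noteq> 0" "z \<noteq> 1"
  shows "(zeta_logderiv has_field_derivative
    deriv (\<lambda>z. deriv riemann_xi z / riemann_xi z) z - Polygamma 1 (1 + z / 2) / 4 + 1 / (z - 1)\<^sup>2) (at z)"
proof -
  have xi: "riemann_xi z \<noteq> 0" using assms riemann_xi_eq_0_iff by blast
  have G: "1 + z / 2 \<notin> \<int>\<^sub>\<le>\<^sub>0" using assms by (intro not_nonpos_Ints_if_Re_pos) simp
  have "deriv riemann_xi field_differentiable (at z)"
    by (rule holomorphic_on_imp_differentiable_at[OF holomorphic_deriv[OF holomorphic_riemann_xi open_UNIV] open_UNIV]) simp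
  moreover have "riemann_xi field_differentiable (at z)"
    using has_field_derivative_riemann_xi unfolding field_differentiable_def by blast
  ultimately have "(\<lambda>z. deriv riemann_xi z / riemann_xi z) field_differentiable (at z)"
    using xi by (intro field_differentiable_divide)
  then have d1: "((\<lambda>z. deriv riemann_xi z / riemann_xi z) has_field_derivative
      deriv (\<lambda>z. deriv riemann_xi z / riemann_xi z) z) (at z)"
    by (simp add: field_differentiable_derivI)
  have d2: "((\<lambda>z. Digamma (1 + z / 2)) has_field_derivative Polygamma (Suc 0) (1 + z / 2) * (1 / 2)) (at z)"
    by (rule DERIV_chain2[where g = "\<lambda>z. 1 + z / 2", OF has_field_derivative_Polygamma[OF G]]) (auto intro!: derivative_eq_intros)
  have d3: "((\<lambda>z. 1 / (z - 1)) has_field_derivative - (1 / (z - 1)\<^sup>2)) (at z)"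
    using assms(3) by (auto intro!: derivative_eq_intros simp: power2_eq_square field_simps)
  show ?thesis unfolding zeta_logderiv_def[abs_def]
    by (rule DERIV_cong[OF DERIV_diff[OF DERIV_diff[OF DERIV_add[OF d1 DERIV_const] DERIV_cdivide[OF d2]] d3]]) simp
qed

lemma has_real_derivative_theta:
  "(riemann_siegel_theta has_real_derivative (Re (Digamma (1 / 4 + \<i> * of_real u / 2)) / 2 - ln pi / 2)) (at u)"
proof -
  have nr: "1 / 4 + \<i> * of_real u / 2 \<notin> \<real>\<^sub>\<le>\<^sub>0" by (auto simp: complex_nonpos_Reals_iff)
  have "((\<lambda>z. ln_Gamma (1 / 4 + \<i> * z / 2)) has_field_derivative Digamma (1 / 4 + \<i> * of_real u / 2) * (\<i> / 2)) (at (of_real u))"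
    by (rule DERIV_chain2[where g = "\<lambda>z. 1 / 4 + \<i> * z / 2", OF has_field_derivative_ln_Gamma_complex[OF nr]]) (auto intro!: derivative_eq_intros)
  from has_vector_derivative_real_field[OF this]
  have "((\<lambda>u. Im (ln_Gamma (1 / 4 + \<i> * of_real u / 2))) has_vector_derivative
      Im (Digamma (1 / 4 + \<i> * of_real u / 2) * (\<i> / 2))) (at u)"
    by (rule bounded_linear.has_vector_derivative[OF bounded_linear_Im])
  then have "((\<lambda>u. Im (ln_Gamma (1 / 4 + \<i> * of_real u / 2))) has_real_derivative
      Re (Digamma (1 / 4 + \<i> * of_real u / 2)) / 2) (at u)"
    by (simp add: has_real_derivative_iff_has_vector_derivative)
  moreover have "((\<lambda>u. u / 2 * ln pi) has_real_derivative ln pi / 2) (at u)"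
    by (auto intro!: derivative_eq_intros)
  ultimately show ?thesis
    unfolding riemann_siegel_theta_def[abs_def] by (rule DERIV_diff)
qed

lemma has_real_derivative_theta':
  "((\<lambda>u. Re (Digamma (1 / 4 + \<i> * of_real u / 2)) / 2 - ln pi / 2) has_real_derivative
     (- Im (Polygamma 1 (1 / 4 + \<i> * of_real u / 2)) / 4)) (at u)"
proof -
  have nr: "1 / 4 + \<i> * of_real u / 2 \<notin> \<int>\<^sub>\<le>\<^sub>0" by (intro not_nonpos_Ints_if_Re_pos) simp
  have "((\<lambda>z. Digamma (1 / 4 + \<i> * z / 2)) has_field_derivative Polygamma (Suc 0) (1 / 4 + \<i> * of_real u / 2) * (\<i> / 2)) (at (of_real u))"
    by (rule DERIV_chain2[where g = "\<lambda>z. 1 / 4 + \<i> * z / 2", OF has_field_derivative_Polygamma[OF nr]]) (auto intro!: derivative_eq_intros)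
  from has_vector_derivative_real_field[OF this]
  have "((\<lambda>u. Re (Digamma (1 / 4 + \<i> * of_real u / 2))) has_vector_derivative
      Re (Polygamma (Suc 0) (1 / 4 + \<i> * of_real u / 2) * (\<i> / 2))) (at u)"
    by (rule bounded_linear.has_vector_derivative[OF bounded_linear_Re])
  then have "((\<lambda>u. Re (Digamma (1 / 4 + \<i> * of_real u / 2))) has_real_derivative
      - Im (Polygamma 1 (1 / 4 + \<i> * of_real u / 2)) / 2) (at u)"
    by (simp add: has_real_derivative_iff_has_vector_derivative)
  then have "((\<lambda>u. Re (Digamma (1 / 4 + \<i> * of_real u / 2)) / 2 - ln pi / 2) has_real_derivative
     (- Im (Polygamma 1 (1 / 4 + \<i> * of_real u / 2)) / 2 / 2 - 0)) (at u)"
    by (intro DERIV_diff DERIV_cdivide DERIV_const)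
  then show ?thesis by simp
qed

lemma has_vector_derivative_zeta_line_compose:
  assumes "(f has_field_derivative D) (at (1 / 2 + \<i> * of_real u))"
  shows "((\<lambda>u. f (1 / 2 + \<i> * of_real u)) has_vector_derivative \<i> * D) (at u)"
proof -
  have "((\<lambda>z. f (1 / 2 + \<i> * z)) has_field_derivative D * \<i>) (at (of_real u))"
    by (rule DERIV_chain2[where g = "\<lambda>z. 1 / 2 + \<i> * z", OF assms]) (auto intro!: derivative_eq_intros)
  from has_vector_derivative_real_field[OF this] show ?thesis by (simp add: mult.commute)
qed

lemma hardy_Z_logderiv:
  assumes "riemann_zeta (1 / 2 + \<i> * of_real u) \<noteq> 0"
  shows "vector_derivative hardy_Z (at u) / hardy_Z u =
    \<i> * of_real (Re (Digamma (1 / 4 + \<i> * of_real u / 2)) / 2 - ln pi / 2) + \<i> * zeta_logderiv (1 / 2 + \<i> * of_real u)"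
proof -
  define \<theta>' where "\<theta>' = Re (Digamma (1 / 4 + \<i> * of_real u / 2)) / 2 - ln pi / 2"
  define s where "s = 1 / 2 + \<i> * of_real u"
  have s1: "s \<noteq> 1" by (simp add: s_def complex_eq_iff)
  have "(riemann_zeta has_field_derivative riemann_zeta s * zeta_logderiv s) (at s)"
    by (rule has_field_derivative_riemann_zeta) (use assms s1 in \<open>auto simp: s_def\<close>)
  then have z: "((\<lambda>u. riemann_zeta (1 / 2 + \<i> * of_real u)) has_vector_derivative \<i> * (riemann_zeta s * zeta_logderiv s)) (at u)"
    unfolding s_def by (rule has_vector_derivative_zeta_line_compose)
  have "((\<lambda>u. \<i> * complex_of_real (riemann_siegel_theta u)) has_vector_derivative \<i> * of_real \<theta>') (at u)"
    unfolding \<theta>'_def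
    by (intro has_vector_derivative_mult_right has_vector_derivative_of_real has_real_derivative_theta)
  then have e: "((\<lambda>u. exp (\<i> * complex_of_real (riemann_siegel_theta u))) has_vector_derivative
      (\<i> * of_real \<theta>') * exp (\<i> * complex_of_real (riemann_siegel_theta u))) (at u)"
    using field_vector_diff_chain_at[OF _ DERIV_exp] by (fastforce simp: o_def)
  have "(hardy_Z has_vector_derivative
     (exp (\<i> * complex_of_real (riemann_siegel_theta u)) * (\<i> * (riemann_zeta s * zeta_logderiv s)) +
      (\<i> * of_real \<theta>') * exp (\<i> * complex_of_real (riemann_siegel_theta u)) * riemann_zeta s)) (at u)"
    unfolding hardy_Z_def[abs_def] using has_vector_derivative_mult[OF e z] by (simp add: s_def)
  then have "vector_derivative hardy_Z (at u) = hardy_Z u * (\<i> * of_real \<theta>' + \<i> * zeta_logderiv s)"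
    by (subst vector_derivative_at) (auto simp: hardy_Z_def s_def algebra_simps)
  moreover have "hardy_Z u \<noteq> 0" using assms by (simp add: hardy_Z_def)
  ultimately show ?thesis by (simp add: \<theta>'_def s_def)
qed

lemma hardy_Z_logderiv_deriv:
  fixes t :: real
  assumes nz: "riemann_zeta (1 / 2 + \<i> * of_real t) \<noteq> 0"
  defines "s \<equiv> 1 / 2 + \<i> * of_real t"
  shows "vector_derivative (\<lambda>u. vector_derivative hardy_Z (at u) / hardy_Z u) (at t) =
    \<i> * of_real (- Im (Polygamma 1 (1 / 4 + \<i> * of_real t / 2)) / 4)
    - (deriv (\<lambda>z. deriv riemann_xi z / riemann_xi z) s - Polygamma 1 (1 + s / 2) / 4 + 1 / (s - 1)\<^sup>2)"
    (is "_ = ?R")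
proof -
  \<comment> \<open>The formula for Z'/Z is available only off the zeros. To differentiate it at
    \<open>t\<close>, it must hold on an open set around \<open>t\<close>, which continuity of zeta
    along the line provides.\<close>
  define N where "N = {u::real. riemann_zeta (1 / 2 + \<i> * of_real u) \<noteq> 0}"
  have cont: "continuous_on UNIV (\<lambda>u::real. riemann_zeta (1 / 2 + \<i> * of_real u))"
    by (rule continuous_on_compose2[OF holomorphic_on_imp_continuous_on[OF holomorphic_riemann_zeta[of "- {1}"]]])
       (auto intro!: continuous_intros simp: complex_eq_iff)
  have N: "open N" unfolding N_def by (intro open_Collect_neq cont continuous_on_const)
  have s1: "s \<noteq> 1" by (simp add: s_def complex_eq_iff)
  have lz: "((\<lambda>u. zeta_logderiv (1 / 2 + \<i> * of_real u)) has_vector_derivative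
      \<i> * (deriv (\<lambda>z. deriv riemann_xi z / riemann_xi z) s - Polygamma 1 (1 + s / 2) / 4 + 1 / (s - 1)\<^sup>2)) (at t)"
    unfolding s_def
    by (intro has_vector_derivative_zeta_line_compose has_field_derivative_zeta_logderiv)
       (use nz s1 in \<open>auto simp: s_def\<close>)
  have "((\<lambda>u. \<i> * of_real (Re (Digamma (1 / 4 + \<i> * of_real u / 2)) / 2 - ln pi / 2) + \<i> * zeta_logderiv (1 / 2 + \<i> * of_real u))
      has_vector_derivative (\<i> * of_real (- Im (Polygamma 1 (1 / 4 + \<i> * of_real t / 2)) / 4) +
        \<i> * (\<i> * (deriv (\<lambda>z. deriv riemann_xi z / riemann_xi z) s - Polygamma 1 (1 + s / 2) / 4 + 1 / (s - 1)\<^sup>2)))) (at t)"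
    by (intro has_vector_derivative_add has_vector_derivative_mult_right has_vector_derivative_of_real
        has_real_derivative_theta' lz)
  also have "\<i> * (\<i> * x) = - x" for x by (simp add: mult.assoc[symmetric])
  finally have "((\<lambda>u. \<i> * of_real (Re (Digamma (1 / 4 + \<i> * of_real u / 2)) / 2 - ln pi / 2) + \<i> * zeta_logderiv (1 / 2 + \<i> * of_real u))
      has_vector_derivative ?R) (at t)" by (simp only: diff_conv_add_uminus)
  then have "((\<lambda>u. vector_derivative hardy_Z (at u) / hardy_Z u) has_vector_derivative ?R) (at t)"
    by (rule has_vector_derivative_transform_within_open[OF _ N]) (use nz hardy_Z_logderiv in \<open>auto simp: N_def\<close>)
  then show ?thesis by (rule vector_derivative_at)
qed

text \<open>Summability is asserted separately because the infinite sum of a non-summable family is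
  0 by convention. Counting with multiplicity is expressed by weighting each zero with
  \<open>zorder\<close>.\<close>

theorem mainTheorem2:
  assumes "riemann_hypothesis"
  shows "\<exists>K>0. \<exists>T>0. \<forall>t::real. t \<ge> T \<and> riemann_zeta (1 / 2 + \<i> * of_real t) \<noteq> 0 \<longrightarrow>
    (\<lambda>\<rho>. of_int (zorder riemann_zeta \<rho>) / (t - Im \<rho>)\<^sup>2) summable_on nontrivial_zeros \<and>
    cmod (complex_of_real
            (\<Sum>\<^sub>\<infinity>\<rho>\<in>nontrivial_zeros. of_int (zorder riemann_zeta \<rho>) / (t - Im \<rho>)\<^sup>2)
        - (- vector_derivative (\<lambda>u. vector_derivative hardy_Z (at u) / hardy_Z u) (at t)))
      \<le> K / t"
proof (rule exI[of _ 7], intro conjI exI[of _ "1::real"] allI impI; (elim conjE)?)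
  \<comment> \<open>The trigamma bound is used at y = t/2, which requires t >= 1 and gives 12/t.
    Each of the two trigamma values enters with weight 1/4 and 1/(s - 1)^2 is at most 1/t, so K = 3
    + 3 + 1.\<close>
  fix t :: real
  assume t: "1 \<le> t" and nz: "riemann_zeta (1 / 2 + \<i> * of_real t) \<noteq> 0"
  define s where "s = 1 / 2 + \<i> * complex_of_real t"
  define D where "D = deriv (\<lambda>z. deriv riemann_xi z / riemann_xi z) s"
  have s1: "s \<noteq> 1" by (simp add: s_def complex_eq_iff)
  have seq: "complex_of_real (1 / 2) + \<i> * of_real t = s" by (simp add: s_def)
  have xi: "riemann_xi s \<noteq> 0" using riemann_xi_eq_0_iff[of s] nz s1 by (simp add: s_def)
  have line: "Re \<rho> = 1 / 2" if "riemann_xi \<rho> = 0" for \<rho>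
    using that assms riemann_xi_zeros unfolding riemann_hypothesis_def by blast
  note H = entire_zeros_critical_line_has_sum[OF holomorphic_riemann_xi riemann_xi_0 norm_riemann_xi_le
      xi_growth_limit line, of t, unfolded seq, OF _ xi, folded D_def]
  have hs: "((\<lambda>\<rho>. of_int (zorder riemann_zeta \<rho>) / (t - Im \<rho>)\<^sup>2) has_sum Re D) nontrivial_zeros"
    using H(1) zorder_riemann_xi unfolding riemann_xi_zeros by (simp cong: has_sum_cong)
  show "(\<lambda>\<rho>. real_of_int (zorder riemann_zeta \<rho>) / (t - Im \<rho>)\<^sup>2) summable_on nontrivial_zeros"
    using hs by (rule has_sum_imp_summable)
  have S: "complex_of_real (\<Sum>\<^sub>\<infinity>\<rho>\<in>nontrivial_zeros. of_int (zorder riemann_zeta \<rho>) / (t - Im \<rho>)\<^sup>2) = D"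
    using infsumI[OF hs] H(2) by simp
  define P Q where "P = Polygamma 1 (1 / 4 + \<i> * complex_of_real t / 2)" and "Q = Polygamma 1 (1 + s / 2)"
  have P: "norm P \<le> 12 / t"
  proof -
    have "1 / 4 + \<i> * complex_of_real t / 2 = of_real (1 / 4) + \<i> * of_real (t / 2)" by simp
    then show ?thesis using Polygamma_1_le[of "1 / 4" "t / 2"] t unfolding P_def by simp
  qed
  have Q: "norm Q \<le> 12 / t"
  proof -
    have "1 + s / 2 = of_real (5 / 4) + \<i> * of_real (t / 2)" by (simp add: s_def complex_eq_iff)
    then show ?thesis using Polygamma_1_le[of "5 / 4" "t / 2"] t unfolding Q_def by simp
  qed
  have s2: "norm (1 / (s - 1)\<^sup>2) \<le> 1 / t"
  proof -
    have "t \<le> t\<^sup>2" using t by (simp add: power2_eq_square)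
    also have "\<dots> \<le> (norm (s - 1))\<^sup>2" by (simp add: s_def cmod_power2)
    finally show ?thesis using t by (simp add: norm_divide norm_power frac_le)
  qed
  \<comment> \<open>The derivative of Z'/Z contributes exactly -D, so the sum over the zeros cancels
    and only the trigamma values and the polar term are left to estimate.\<close>
  have eq: "D - (- (\<i> * of_real (- Im P / 4) - (D - Q / 4 + 1 / (s - 1)\<^sup>2))) =
     \<i> * of_real (- Im P / 4) + Q / 4 - 1 / (s - 1)\<^sup>2" by simp
  have "norm (\<i> * of_real (- Im P / 4) + Q / 4 - 1 / (s - 1)\<^sup>2) \<le> norm P / 4 + norm Q / 4 + norm (1 / (s - 1)\<^sup>2)"
    using abs_Im_le_cmod[of P]
    by (intro order_trans[OF norm_triangle_ineq4] order_trans[OF norm_triangle_ineq] add_mono)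
       (auto simp: norm_mult norm_divide)
  also have "\<dots> \<le> 7 / t" using P Q s2 by simp
  finally show "cmod (complex_of_real
            (\<Sum>\<^sub>\<infinity>\<rho>\<in>nontrivial_zeros. of_int (zorder riemann_zeta \<rho>) / (t - Im \<rho>)\<^sup>2)
        - (- vector_derivative (\<lambda>u. vector_derivative hardy_Z (at u) / hardy_Z u) (at t)))
      \<le> 7 / t"
    unfolding S hardy_Z_logderiv_deriv[OF nz] s_def[symmetric] D_def[symmetric] P_def[symmetric] Q_def[symmetric] eq .
qed simp_all

end
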